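(* Let $\mu$ be a probability measure on $\mathbb Z^d$, let $E\subset\mathbb Z^d$ satisfy $0\in E$ and $x+u\in E$ for all $x,u\in E$, and let $(X(t))$ be the substochastic random walk on $E$ with transition probabilities $p(x,y)=\mu(y-x)$, $x,y\in E$, assumed irreducible and transient on $E$. Let $(H_n)$ be the ladder height process relative to $(X(t))$, let $\mathcal T_\vartheta=\inf\{n>0:H_n=\vartheta\}$, let $V(x)=\mathbb E_x(\mathcal T_\vartheta)$ for $x\in E$, $V(\vartheta)=0$, and for $x\in E$ let $\eta_x=\inf\{t>0:X(t)\notin E+x\}$. Then: (i) The ladder height process $(H_n)$ is transient on $E$. (ii) $V$ is finite with $V(0)=1$ and $$V(x+u)=V(x)+\mathbb E_{x+u}\bigl(V(X(\eta_u)),\ \eta_u<\tau_\vartheta\le\infty\bigr),\qquad\forall x,u\in E.$$ (iii) If $\mathbb E_x(\tau_\vartheta)=+\infty$ for all $x\in E$, then $V$ is harmonic for $(X(t))$ and $\lim_{n\to\infty}\mathbb P_x(\tau_\vartheta>n)/\mathbb P_0(\tau_\vartheta>n)=V(x)$ for any $x\in E$. (iv) If $\mathbb E_x(\tau_\vartheta)<+\infty$ for all $x\in E$, then $V$ is a potential function for $(X(t))$ and for any $x\in E$ $$V(x)=\frac{\mathbb E_x(\tau_\vartheta)}{\mathbb E_0(\tau_\vartheta)}\le\liminf_{n\to\infty}\frac{\mathbb P_x(\tau_\vartheta>n)}{\mathbb P_0(\tau_\vartheta>n)}.$$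
   Context: Irreducible: for all $x,y\in E$ there is $n\ge1$ with $\mathbb P_x(X(n)=y)>0$. $(X(t))$ is the homogeneous random walk on $\mathbb Z^d$ with step distribution $\mu$ killed upon its first exit from $E$: it jumps from $x\in E$ to an absorbing state $\vartheta$ with probability $1-\sum_{y\in E}\mu(y-x)$, and $\tau_\vartheta=\inf\{n>0:X(n)=\vartheta\}$. By irreducibility $x\mapsto\mathbb E_x(\tau_\vartheta)$ is either finite everywhere or infinite everywhere on $E$. $G(x,y)=\sum_{t\ge0}\mathbb P_x(X(t)=y)$, $x,y\in E$. A harmonic function is a non-zero $h:E\to[0,\infty)$ with $\sum_{y\in E}p(x,y)h(y)=h(x)$; a potential function is a function $g:E\to[0,\infty)$ of the form $g(x)=\sum_{y\in E}G(x,y)\varphi(y)$ with $\varphi:E\to[0,\infty)$. The ladder height process $(H_n)$ is the Markov chain on $E\cup\{\vartheta\}$ with $p_H(x,y)=\sum_{z\in E}G(0,z)\,a_x(z,y)$ for $x,y\in E$, where $a_x(z,y)=\mu(y-z-x)$ if $y\in E\setminus(E+x)$ and $a_x(z,y)=0$ if $y\in E+x$; $p_H(x,\vartheta)=1-\sum_{y\in E}p_H(x,y)$; and $\vartheta$ absorbing. Transience of $(H_n)$ on $E$ means $\sum_{n\ge0}\mathbb P_x(H_n=y)<\infty$ for all $x,y\in E$. *)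

theory Defs
  imports "HOL-Probability.Probability"
begin

section \<open>Markov chains on a countable state space\<close>

text \<open>
  \<open>chain_law K x\<close> is the law, on the path space \<open>nat \<Rightarrow> 's\<close>, of the Markov chain with
  transition kernel \<open>K\<close> started at \<open>x\<close>; the chain itself is the coordinate process, so
  that the probability of \<open>X(n) = y\<close> under \<open>x\<close> is the \<open>chain_law K x\<close>-measure of
  \<open>{\<omega>. \<omega> n = y}\<close>.  It is built from independent variables \<open>U (n, s)\<close> of law \<open>K s\<close>
  through \<open>X(n + 1) = U (n, X(n))\<close>.  Lemma \<open>chain_law_cylinder\<close> gives the
  finite-dimensional distributions, which characterise the law.
\<close>

primrec chain_path :: "'s \<Rightarrow> (nat \<times> 's \<Rightarrow> 's) \<Rightarrow> nat \<Rightarrow> 's" where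
  "chain_path x U 0 = x"
| "chain_path x U (Suc n) = U (n, chain_path x U n)"

definition chain_law :: "('s::countable \<Rightarrow> 's pmf) \<Rightarrow> 's \<Rightarrow> (nat \<Rightarrow> 's) measure" where
  "chain_law K x =
     distr (\<Pi>\<^sub>M i\<in>UNIV. measure_pmf (K (snd i))) (\<Pi>\<^sub>M n\<in>UNIV. count_space UNIV) (chain_path x)"

lemma measurable_chain_path [measurable]:
  fixes K :: "'s::countable \<Rightarrow> 's pmf"
  shows "chain_path x \<in> (\<Pi>\<^sub>M i\<in>UNIV. measure_pmf (K (snd i))) \<rightarrow>\<^sub>M (\<Pi>\<^sub>M n\<in>UNIV. count_space UNIV)"
proof (rule measurable_PiM_single')
  let ?M = "\<Pi>\<^sub>M i\<in>UNIV. measure_pmf (K (snd i))"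
  fix n :: nat
  show "(\<lambda>U. chain_path x U n) \<in> ?M \<rightarrow>\<^sub>M count_space UNIV"
  proof (induction n)
    case (Suc n)
    have c: "(\<lambda>U. U (n, s)) \<in> ?M \<rightarrow>\<^sub>M count_space UNIV" for s
      using measurable_component_singleton[of "(n, s)" UNIV "\<lambda>i. measure_pmf (K (snd i))"]
      by (simp cong: measurable_cong_sets)
    have "(\<lambda>U. U (n, chain_path x U n)) \<in> ?M \<rightarrow>\<^sub>M count_space UNIV"
      by (rule measurable_compose_countable'[OF c Suc]) auto
    then show ?case by simp
  qed simp
qed (auto simp: space_PiM)

lemma sets_chain_law [simp, measurable_cong]:
  "sets (chain_law K x) = sets (\<Pi>\<^sub>M n\<in>UNIV. count_space UNIV)"
  by (simp add: chain_law_def)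

lemma space_chain_law [simp]: "space (chain_law K x) = UNIV"
  by (simp add: chain_law_def space_PiM)

lemma prob_space_chain_law: "prob_space (chain_law K x)"
  unfolding chain_law_def
  by (rule prob_space.prob_space_distr[OF prob_space_PiM]) (auto simp: measure_pmf.prob_space_axioms)

lemma sets_chain_coordinate:
  "{\<omega>. \<omega> n = s} \<in> sets (\<Pi>\<^sub>M n\<in>(UNIV :: nat set). count_space UNIV)"
proof -
  have "(\<lambda>\<omega>. \<omega> n) \<in> (\<Pi>\<^sub>M n\<in>(UNIV :: nat set). count_space UNIV) \<rightarrow>\<^sub>M count_space UNIV"
    by measurable
  from measurable_sets[OF this, of "{s}"] show ?thesis
    by (simp add: vimage_def space_PiM)
qed

lemma sets_chain_cylinder:
  "{\<omega>. \<forall>i\<le>n. \<omega> i = s i} \<in> sets (\<Pi>\<^sub>M n\<in>(UNIV :: nat set). count_space UNIV)"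
proof -
  have "{\<omega>. \<forall>i\<le>n. \<omega> i = s i} = (\<Inter>i\<in>{..n}. {\<omega>. \<omega> i = s i})" by auto
  then show ?thesis by (auto intro!: sets.finite_INT sets_chain_coordinate)
qed

lemma chain_law_cylinder:
  fixes K :: "'s::countable \<Rightarrow> 's pmf"
  shows "emeasure (chain_law K x) {\<omega>. \<forall>i\<le>n. \<omega> i = s i} =
    (if s 0 = x then \<Prod>i<n. ennreal (pmf (K (s i)) (s (Suc i))) else 0)"
proof -
  let ?M = "\<Pi>\<^sub>M i\<in>UNIV. measure_pmf (K (snd i))"
  interpret product_prob_space "\<lambda>i::nat \<times> 's. measure_pmf (K (snd i))" UNIV
    by (rule product_prob_spaceI) (rule measure_pmf.prob_space_axioms)
  have path: "(\<forall>i\<le>n. chain_path x U i = s i) \<longleftrightarrow> s 0 = x \<and> (\<forall>i<n. U (i, s i) = s (Suc i))" for U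
    by (induction n) (auto simp: le_Suc_eq less_Suc_eq)
  let ?J = "(\<lambda>i. (i, s i)) ` {..<n}"
  have inj: "inj_on (\<lambda>i. (i, s i)) {..<n}" by (auto simp: inj_on_def)
  have "{\<omega>. \<forall>i\<le>n. \<omega> i = s i} \<in> sets (\<Pi>\<^sub>M n\<in>UNIV. count_space UNIV)"
    by (rule sets_chain_cylinder)
  then have "emeasure (chain_law K x) {\<omega>. \<forall>i\<le>n. \<omega> i = s i} =
      emeasure ?M {U\<in>space ?M. s 0 = x \<and> (\<forall>i<n. U (i, s i) = s (Suc i))}"
    unfolding chain_law_def
    by (subst emeasure_distr) (auto simp: path[symmetric] space_PiM intro!: arg_cong[where f = "emeasure ?M"])
  also have "\<dots> = (if s 0 = x then emeasure ?M {U\<in>space ?M. \<forall>j\<in>?J. U j \<in> {s (Suc (fst j))}} else 0)"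
    by (auto intro!: arg_cong[where f = "emeasure ?M"])
  also have "emeasure ?M {U\<in>space ?M. \<forall>j\<in>?J. U j \<in> {s (Suc (fst j))}} =
      (\<Prod>j\<in>?J. emeasure (measure_pmf (K (snd j))) {s (Suc (fst j))})"
    by (rule emeasure_PiM_Collect) auto
  also have "\<dots> = (\<Prod>i<n. ennreal (pmf (K (s i)) (s (Suc i))))"
    by (subst prod.reindex[OF inj]) (simp add: emeasure_pmf_single)
  finally show ?thesis .
qed

lemma chain_law_step:
  fixes K :: "'s::countable \<Rightarrow> 's pmf"
  shows "emeasure (chain_law K x) {\<omega>. \<omega> n = y \<and> \<omega> (Suc n) = z} =
    emeasure (chain_law K x) {\<omega>. \<omega> n = y} * ennreal (pmf (K y) z)"
proof -
  let ?P = "chain_law K x"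
  let ?c = "\<lambda>l::'s list. {\<omega>. \<forall>i\<le>n. \<omega> i = l ! i}"
  define I where "I = {l::'s list. length l = Suc n \<and> l ! n = y}"
  have cyl: "{\<omega>. \<forall>i\<le>m. \<omega> i = s i} \<in> sets ?P" for s :: "nat \<Rightarrow> 's" and m
    using sets_chain_cylinder by simp
  have one: "{\<omega>. \<omega> m = s} \<in> sets ?P" for m and s :: 's
    using sets_chain_coordinate by simp
  have disj: "disjoint_family_on ?c I"
    by (auto simp: disjoint_family_on_def I_def list_eq_iff_nth_eq less_Suc_eq_le)
  have ext: "\<omega> \<in> ?c (map \<omega> [0..<Suc n])" for \<omega> :: "nat \<Rightarrow> 's"
    by (auto simp: less_Suc_eq_le simp del: upt_Suc)
  have un: "{\<omega>. \<omega> n = y} = (\<Union>l\<in>I. ?c l)"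
  proof (intro set_eqI iffI)
    fix \<omega> :: "nat \<Rightarrow> 's" assume "\<omega> \<in> {\<omega>. \<omega> n = y}"
    then have "map \<omega> [0..<Suc n] \<in> I" by (simp add: I_def nth_append)
    with ext[of \<omega>] show "\<omega> \<in> (\<Union>l\<in>I. ?c l)" by blast
  qed (auto simp: I_def)
  have one_step: "emeasure ?P (?c l \<inter> {\<omega>. \<omega> (Suc n) = z}) = emeasure ?P (?c l) * ennreal (pmf (K y) z)"
    if "l \<in> I" for l
  proof -
    define s where "s i = (if i \<le> n then l ! i else z)" for i
    have eq: "?c l \<inter> {\<omega>. \<omega> (Suc n) = z} = {\<omega>. \<forall>i\<le>Suc n. \<omega> i = s i}"
      "?c l = {\<omega>. \<forall>i\<le>n. \<omega> i = s i}"
      by (auto simp: s_def le_Suc_eq)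
    have "s n = y" "s (Suc n) = z" using that by (auto simp: s_def I_def)
    then show ?thesis
      by (subst eq(1), subst eq(2)) (simp add: chain_law_cylinder)
  qed
  have "{\<omega>. \<omega> n = y \<and> \<omega> (Suc n) = z} = (\<Union>l\<in>I. ?c l \<inter> {\<omega>. \<omega> (Suc n) = z})"
    using un by auto
  also have "emeasure ?P \<dots> = (\<integral>\<^sup>+l. emeasure ?P (?c l \<inter> {\<omega>. \<omega> (Suc n) = z}) \<partial>count_space I)"
    by (rule emeasure_UN_countable)
       (use disj cyl one in \<open>auto simp: disjoint_family_on_def intro!: sets.Int\<close>)
  also have "\<dots> = (\<integral>\<^sup>+l. emeasure ?P (?c l) * ennreal (pmf (K y) z) \<partial>count_space I)"
    by (rule nn_integral_cong) (simp add: one_step)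
  also have "\<dots> = (\<integral>\<^sup>+l. emeasure ?P (?c l) \<partial>count_space I) * ennreal (pmf (K y) z)"
    by (rule nn_integral_multc) simp
  also have "(\<integral>\<^sup>+l. emeasure ?P (?c l) \<partial>count_space I) = emeasure ?P (\<Union>l\<in>I. ?c l)"
    by (rule emeasure_UN_countable[symmetric]) (use disj cyl in auto)
  finally show ?thesis by (simp only: un)
qed

section \<open>Substochastic kernels and the cemetery\<close>

text \<open>
  The cemetery is \<open>None\<close>; the points of \<open>E\<close> are \<open>Some x\<close>.  For \<open>p x\<close> of total mass at most
  one on \<open>E\<close>, the missing mass is sent to the absorbing state \<open>None\<close>, see
  \<open>pmf_cemetery_kernel\<close>.
\<close>

definition cemetery_kernel :: "'a set \<Rightarrow> ('a \<Rightarrow> 'a \<Rightarrow> ennreal) \<Rightarrow> 'a option \<Rightarrow> 'a option pmf" where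
  "cemetery_kernel E p s = (case s of
     None \<Rightarrow> return_pmf None
   | Some x \<Rightarrow> embed_pmf (\<lambda>s'. case s' of
         None \<Rightarrow> enn2real (1 - (\<integral>\<^sup>+y. p x y \<partial>count_space E))
       | Some y \<Rightarrow> if y \<in> E then enn2real (p x y) else 0))"

lemma pmf_cemetery_kernel:
  fixes p :: "'a::countable \<Rightarrow> 'a \<Rightarrow> ennreal"
  assumes sub: "(\<integral>\<^sup>+y. p x y \<partial>count_space E) \<le> 1"
  shows "y \<in> E \<Longrightarrow> ennreal (pmf (cemetery_kernel E p (Some x)) (Some y)) = p x y"
    and "y \<notin> E \<Longrightarrow> pmf (cemetery_kernel E p (Some x)) (Some y) = 0"
    and "ennreal (pmf (cemetery_kernel E p (Some x)) None) = 1 - (\<integral>\<^sup>+y. p x y \<partial>count_space E)"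
proof -
  let ?m = "\<integral>\<^sup>+y. p x y \<partial>count_space E"
  let ?f = "\<lambda>s'. case s' of None \<Rightarrow> enn2real (1 - ?m) | Some y \<Rightarrow> if y \<in> E then enn2real (p x y) else 0"
  have le: "p x y \<le> ?m" if "y \<in> E" for y
    using nn_integral_ge_point[OF that, of "p x"] .
  have fin: "p x y < \<top>" if "y \<in> E" for y
    using le[OF that] sub by (meson ennreal_one_less_top le_less_trans)
  have mfin: "1 - ?m < \<top>"
    by (meson diff_le_self_ennreal ennreal_one_less_top le_less_trans)
  have split: "(UNIV :: 'a option set) = insert None (Some ` UNIV)"
    by (metis UNIV_option_conv)
  have "(\<integral>\<^sup>+s'. ennreal (?f s') \<partial>count_space UNIV) =
      (\<integral>\<^sup>+s'. ennreal (?f s') * indicator {None} s' + ennreal (?f s') * indicator (range Some) s' \<partial>count_space UNIV)"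
    by (intro nn_integral_cong) (auto split: option.split split_indicator)
  also have "\<dots> = (\<integral>\<^sup>+s'. ennreal (?f s') * indicator {None} s' \<partial>count_space UNIV) +
      (\<integral>\<^sup>+s'. ennreal (?f s') * indicator (range Some) s' \<partial>count_space UNIV)"
    by (rule nn_integral_add) auto
  also have "(\<integral>\<^sup>+s'. ennreal (?f s') * indicator {None} s' \<partial>count_space UNIV) = 1 - ?m"
    using mfin by (subst nn_integral_indicator_singleton) auto
  also have "(\<integral>\<^sup>+s'. ennreal (?f s') * indicator (range Some) s' \<partial>count_space UNIV) =
      (\<integral>\<^sup>+s'. ennreal (?f s') \<partial>count_space (range Some))"
    by (simp add: nn_integral_count_space_indicator)
  also have "\<dots> = (\<integral>\<^sup>+y. ennreal (?f (Some y)) \<partial>count_space UNIV)"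
    by (rule nn_integral_bij_count_space[symmetric]) (auto simp: bij_betw_def)
  also have "\<dots> = (\<integral>\<^sup>+y. p x y * indicator E y \<partial>count_space UNIV)"
    using fin by (intro nn_integral_cong) (auto split: split_indicator)
  also have "\<dots> = ?m"
    by (simp add: nn_integral_count_space_indicator)
  also have "1 - ?m + ?m = 1"
    using sub by (simp add: diff_add_cancel_ennreal)
  finally have "(\<integral>\<^sup>+s'. ennreal (?f s') \<partial>count_space UNIV) = 1" .
  then have pmf: "pmf (cemetery_kernel E p (Some x)) s' = ?f s'" for s'
    unfolding cemetery_kernel_def option.case(2)
    by (subst pmf_embed_pmf) (auto split: option.split)
  show "y \<in> E \<Longrightarrow> ennreal (pmf (cemetery_kernel E p (Some x)) (Some y)) = p x y"
    using fin by (simp add: pmf)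
  show "y \<notin> E \<Longrightarrow> pmf (cemetery_kernel E p (Some x)) (Some y) = 0"
    by (simp add: pmf)
  show "ennreal (pmf (cemetery_kernel E p (Some x)) None) = 1 - ?m"
    using mfin by (simp add: pmf)
qed

text \<open>
  In the following, \<open>P x\<close> is the law of a chain on \<open>'a option\<close> started at \<open>Some x\<close>.
\<close>

definition green :: "('a \<Rightarrow> (nat \<Rightarrow> 'a option) measure) \<Rightarrow> 'a \<Rightarrow> 'a \<Rightarrow> ennreal" where
  "green P x y = (\<Sum>t. emeasure (P x) {\<omega>. \<omega> t = Some y})"

definition transient_on :: "'a set \<Rightarrow> ('a \<Rightarrow> (nat \<Rightarrow> 'a option) measure) \<Rightarrow> bool" where
  "transient_on E P \<longleftrightarrow> (\<forall>x\<in>E. \<forall>y\<in>E. green P x y < \<infinity>)"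

definition irreducible_on :: "'a set \<Rightarrow> ('a \<Rightarrow> (nat \<Rightarrow> 'a option) measure) \<Rightarrow> bool" where
  "irreducible_on E P \<longleftrightarrow> (\<forall>x\<in>E. \<forall>y\<in>E. \<exists>n\<ge>1. emeasure (P x) {\<omega>. \<omega> n = Some y} > 0)"

definition first_time :: "(nat \<Rightarrow> bool) \<Rightarrow> enat" where
  "first_time A = (INF n\<in>{n. n > 0 \<and> A n}. enat n)"

definition lifetime :: "(nat \<Rightarrow> 'a option) \<Rightarrow> enat" where
  "lifetime \<omega> = first_time (\<lambda>n. \<omega> n = None)"

definition expected_lifetime :: "('a \<Rightarrow> (nat \<Rightarrow> 'a option) measure) \<Rightarrow> 'a \<Rightarrow> ennreal" where
  "expected_lifetime P x = (\<integral>\<^sup>+\<omega>. ennreal_of_enat (lifetime \<omega>) \<partial>P x)"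

definition survival :: "('a \<Rightarrow> (nat \<Rightarrow> 'a option) measure) \<Rightarrow> 'a \<Rightarrow> nat \<Rightarrow> ennreal" where
  "survival P x n = emeasure (P x) {\<omega>. lifetime \<omega> > enat n}"

section \<open>The killed random walk and its ladder height process\<close>

type_synonym 'd lattice = "int ^ 'd"

definition walk_p :: "('d::finite) lattice pmf \<Rightarrow> 'd lattice \<Rightarrow> 'd lattice \<Rightarrow> ennreal" where
  "walk_p \<mu> x y = ennreal (pmf \<mu> (y - x))"

definition walk_law ::
  "('d::finite) lattice pmf \<Rightarrow> 'd lattice set \<Rightarrow> 'd lattice \<Rightarrow> (nat \<Rightarrow> 'd lattice option) measure" where
  "walk_law \<mu> E x = chain_law (cemetery_kernel E (walk_p \<mu>)) (Some x)"

definition ladder_a ::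
  "('d::finite) lattice pmf \<Rightarrow> 'd lattice set \<Rightarrow> 'd lattice \<Rightarrow> 'd lattice \<Rightarrow> 'd lattice \<Rightarrow> ennreal" where
  "ladder_a \<mu> E x z y = (if y \<in> E - (+) x ` E then ennreal (pmf \<mu> (y - z - x)) else 0)"

definition ladder_p ::
  "('d::finite) lattice pmf \<Rightarrow> 'd lattice set \<Rightarrow> 'd lattice \<Rightarrow> 'd lattice \<Rightarrow> ennreal" where
  "ladder_p \<mu> E x y = (\<integral>\<^sup>+z. green (walk_law \<mu> E) 0 z * ladder_a \<mu> E x z y \<partial>count_space E)"

definition ladder_law ::
  "('d::finite) lattice pmf \<Rightarrow> 'd lattice set \<Rightarrow> 'd lattice \<Rightarrow> (nat \<Rightarrow> 'd lattice option) measure" where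
  "ladder_law \<mu> E x = chain_law (cemetery_kernel E (ladder_p \<mu> E)) (Some x)"

definition ladder_V ::
  "('d::finite) lattice pmf \<Rightarrow> 'd lattice set \<Rightarrow> 'd lattice option \<Rightarrow> ennreal" where
  "ladder_V \<mu> E s = (case s of None \<Rightarrow> 0 | Some x \<Rightarrow> expected_lifetime (ladder_law \<mu> E) x)"

definition exit_time :: "('d::finite) lattice set \<Rightarrow> 'd lattice \<Rightarrow> (nat \<Rightarrow> 'd lattice option) \<Rightarrow> enat" where
  "exit_time E u \<omega> = first_time (\<lambda>t. \<omega> t \<notin> Some ` ((+) u ` E))"

text \<open>
  Only the values of \<open>h\<close>, \<open>g\<close>, \<open>\<phi>\<close> on \<open>E\<close> matter; they are non-negative and required to be finite.
\<close>

definition harmonic_on ::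
  "('d::finite) lattice pmf \<Rightarrow> 'd lattice set \<Rightarrow> ('d lattice \<Rightarrow> ennreal) \<Rightarrow> bool" where
  "harmonic_on \<mu> E h \<longleftrightarrow>
     (\<forall>x\<in>E. h x < \<infinity>) \<and> (\<exists>x\<in>E. h x \<noteq> 0) \<and>
     (\<forall>x\<in>E. (\<integral>\<^sup>+y. walk_p \<mu> x y * h y \<partial>count_space E) = h x)"

definition potential_on ::
  "('d::finite) lattice pmf \<Rightarrow> 'd lattice set \<Rightarrow> ('d lattice \<Rightarrow> ennreal) \<Rightarrow> bool" where
  "potential_on \<mu> E g \<longleftrightarrow>
     (\<forall>x\<in>E. g x < \<infinity>) \<and>
     (\<exists>\<phi>. (\<forall>y\<in>E. \<phi> y < \<infinity>) \<and>
       (\<forall>x\<in>E. g x = (\<integral>\<^sup>+y. green (walk_law \<mu> E) x y * \<phi> y \<partial>count_space E)))"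

subsection \<open>Both kernels are substochastic\<close>

lemma nn_integral_pmf_shift:
  "(\<integral>\<^sup>+y. ennreal (pmf \<mu> (y - x)) \<partial>count_space UNIV) = 1" for x :: "('d::finite) lattice"
proof -
  have "(\<integral>\<^sup>+y. ennreal (pmf \<mu> (y - x)) \<partial>count_space UNIV) = (\<integral>\<^sup>+y. ennreal (pmf \<mu> y) \<partial>count_space UNIV)"
    by (rule nn_integral_bij_count_space[where g = "\<lambda>y. y - x"])
       (auto intro!: bij_betwI[where g = "\<lambda>y. y + x"])
  then show ?thesis by (simp add: nn_integral_pmf_eq_1)
qed

lemma walk_p_substochastic: "(\<integral>\<^sup>+y. walk_p \<mu> x y \<partial>count_space E) \<le> 1"
proof -
  have "(\<integral>\<^sup>+y. walk_p \<mu> x y \<partial>count_space E) \<le> (\<integral>\<^sup>+y. walk_p \<mu> x y \<partial>count_space UNIV)"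
    by (subst nn_integral_count_space_indicator)
       (auto intro!: nn_integral_mono split: split_indicator)
  then show ?thesis by (simp add: walk_p_def nn_integral_pmf_shift)
qed

lemma ladder_p_substochastic: "(\<integral>\<^sup>+y. ladder_p \<mu> E x y \<partial>count_space E) \<le> 1"
proof -
  let ?K = "cemetery_kernel E (walk_p \<mu>)" and ?P = "walk_law \<mu> E 0"
  let ?q = "\<lambda>t z. emeasure ?P {\<omega>. \<omega> t = Some z}"
  let ?c = "\<lambda>z. ennreal (pmf (?K (Some z)) None)"
  let ?N = "\<lambda>t. emeasure ?P {\<omega>. \<omega> t = None}"
  have one [simp]: "{\<omega>. \<omega> m = s} \<in> sets ?P" for m s
    using sets_chain_coordinate by (simp add: walk_law_def)
  have two [simp]: "{\<omega>. \<omega> m = s \<and> \<omega> m' = s'} \<in> sets ?P" for m s m' s'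
    using sets.Int[OF one[of m s] one[of m' s']] by (simp add: Collect_conj_eq)
  have step: "emeasure ?P {\<omega>. \<omega> t = s \<and> \<omega> (Suc t) = s'} =
      emeasure ?P {\<omega>. \<omega> t = s} * ennreal (pmf (?K s) s')" for t s s'
    unfolding walk_law_def by (rule chain_law_step)
  have absorb: "ennreal (pmf (?K None) None) = 1"
    by (simp add: cemetery_kernel_def)
  have exit: "(\<integral>\<^sup>+y. ladder_a \<mu> E x z y \<partial>count_space E) \<le> ?c z" for z
  proof -
    let ?in = "\<integral>\<^sup>+y. walk_p \<mu> z y \<partial>count_space E"
    let ?out = "\<integral>\<^sup>+w. ennreal (pmf \<mu> (w - z)) * indicator (- E) w \<partial>count_space UNIV"
    have "(\<integral>\<^sup>+y. ladder_a \<mu> E x z y \<partial>count_space E) =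
        (\<integral>\<^sup>+y. ladder_a \<mu> E x z y * indicator E y \<partial>count_space UNIV)"
      by (simp add: nn_integral_count_space_indicator)
    also have "\<dots> \<le> (\<integral>\<^sup>+y. ennreal (pmf \<mu> ((y - x) - z)) * indicator (- E) (y - x) \<partial>count_space UNIV)"
    proof (rule nn_integral_mono)
      fix y
      have "y - x \<in> E \<Longrightarrow> y \<in> (+) x ` E"
        by (rule image_eqI[where x = "y - x"]) auto
      then show "ladder_a \<mu> E x z y * indicator E y \<le>
          ennreal (pmf \<mu> ((y - x) - z)) * indicator (- E) (y - x)"
        by (auto simp: ladder_a_def diff_diff_eq add.commute split: split_indicator)
    qed
    also have "\<dots> = ?out"
      by (rule nn_integral_bij_count_space[where g = "\<lambda>y. y - x"
            and f = "\<lambda>w. ennreal (pmf \<mu> (w - z)) * indicator (- E) w"])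
         (auto intro!: bij_betwI[where g = "\<lambda>y. y + x"])
    finally have le: "(\<integral>\<^sup>+y. ladder_a \<mu> E x z y \<partial>count_space E) \<le> ?out" .
    have "?out + ?in = (\<integral>\<^sup>+w. ennreal (pmf \<mu> (w - z)) * indicator (- E) w +
        ennreal (pmf \<mu> (w - z)) * indicator E w \<partial>count_space UNIV)"
      unfolding nn_integral_count_space_indicator[of E "walk_p \<mu> z"]
      by (subst nn_integral_add) (auto simp: walk_p_def nn_integral_count_space_indicator)
    also have "\<dots> = (\<integral>\<^sup>+w. ennreal (pmf \<mu> (w - z)) \<partial>count_space UNIV)"
      by (intro nn_integral_cong) (auto split: split_indicator)
    also have "\<dots> = 1" by (rule nn_integral_pmf_shift)
    finally have sum: "?out + ?in = 1" .
    have "?in < \<top>"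
      using walk_p_substochastic[of E \<mu> z] ennreal_one_less_top by (rule le_less_trans)
    then have "?out + ?in - ?in = ?out"
      by (intro ennreal_add_diff_cancel_right) simp
    then have "?out = 1 - ?in"
      unfolding sum by (rule sym)
    also have "\<dots> = ?c z"
      by (rule pmf_cemetery_kernel(3)[symmetric]) (rule walk_p_substochastic)
    finally show ?thesis using le by simp
  qed
  have inc: "?N t + (\<integral>\<^sup>+z. ?q t z * ?c z \<partial>count_space E) \<le> ?N (Suc t)" for t
  proof -
    let ?A = "\<lambda>z. {\<omega>. \<omega> t = Some z \<and> \<omega> (Suc t) = None}"
    have U: "(\<Union>z\<in>E. ?A z) \<in> sets ?P"
      by (rule sets.countable_UN'') auto
    have "?N t = emeasure ?P {\<omega>. \<omega> t = None \<and> \<omega> (Suc t) = None}"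
      by (simp add: step absorb)
    moreover have "(\<integral>\<^sup>+z. ?q t z * ?c z \<partial>count_space E) = (\<integral>\<^sup>+z. emeasure ?P (?A z) \<partial>count_space E)"
      by (simp add: step)
    moreover have "\<dots> = emeasure ?P (\<Union>z\<in>E. ?A z)"
      by (rule emeasure_UN_countable[symmetric]) (auto simp: disjoint_family_on_def)
    moreover have "emeasure ?P {\<omega>. \<omega> t = None \<and> \<omega> (Suc t) = None} + emeasure ?P (\<Union>z\<in>E. ?A z) =
        emeasure ?P ({\<omega>. \<omega> t = None \<and> \<omega> (Suc t) = None} \<union> (\<Union>z\<in>E. ?A z))"
      by (rule plus_emeasure) (use U in auto)
    moreover have "\<dots> \<le> ?N (Suc t)"
      by (rule emeasure_mono) auto
    ultimately show ?thesis by simp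
  qed
  have part: "(\<Sum>t<n. \<integral>\<^sup>+z. ?q t z * ?c z \<partial>count_space E) \<le> ?N n" for n
  proof (induction n)
    case (Suc n)
    have "(\<Sum>t<Suc n. \<integral>\<^sup>+z. ?q t z * ?c z \<partial>count_space E) \<le>
        ?N n + (\<integral>\<^sup>+z. ?q n z * ?c z \<partial>count_space E)"
      unfolding sum.lessThan_Suc by (rule add_right_mono[OF Suc])
    also have "\<dots> \<le> ?N (Suc n)" by (rule inc)
    finally show ?case .
  qed simp
  have "(\<integral>\<^sup>+y. ladder_p \<mu> E x y \<partial>count_space E) =
      (\<integral>\<^sup>+z. (\<integral>\<^sup>+y. green (walk_law \<mu> E) 0 z * ladder_a \<mu> E x z y \<partial>count_space E) \<partial>count_space E)"
    unfolding ladder_p_def by (rule nn_integral_count_space_nn_integral) auto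
  also have "\<dots> = (\<integral>\<^sup>+z. green (walk_law \<mu> E) 0 z * (\<integral>\<^sup>+y. ladder_a \<mu> E x z y \<partial>count_space E) \<partial>count_space E)"
    by (simp add: nn_integral_cmult)
  also have "\<dots> \<le> (\<integral>\<^sup>+z. green (walk_law \<mu> E) 0 z * ?c z \<partial>count_space E)"
    by (intro nn_integral_mono mult_left_mono exit) simp
  also have "\<dots> = (\<integral>\<^sup>+z. (\<Sum>t. ?q t z * ?c z) \<partial>count_space E)"
    by (simp add: green_def)
  also have "\<dots> = (\<Sum>t. \<integral>\<^sup>+z. ?q t z * ?c z \<partial>count_space E)"
    by (rule nn_integral_suminf) simp
  also have "\<dots> \<le> 1"
  proof (rule suminf_le_const)
    fix n
    have "?N n \<le> 1"
      unfolding walk_law_def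
      by (rule prob_space.emeasure_le_1[OF prob_space_chain_law])
    with part[of n] show "(\<Sum>t<n. \<integral>\<^sup>+z. ?q t z * ?c z \<partial>count_space E) \<le> 1"
      by (rule order_trans)
  qed simp
  finally show ?thesis .
qed

end

theory Submission
  imports Defs "HOL-Computational_Algebra.Formal_Power_Series"
begin

text \<open>
  Started at \<open>x\<close>, the walk run between two successive ladder times is a copy of the walk started
  at \<open>0\<close> and run until it is killed.  With \<open>u\<^sub>x(j)\<close> the probability that \<open>j\<close> is a ladder time
  (a renewal sequence), this reads \<open>P\<^sub>x(\<tau> > n) = \<Sum>\<^sub>j u\<^sub>x(j) P\<^sub>0(\<tau> > n - j)\<close>, while
  \<open>V(x) = \<Sum>\<^sub>j u\<^sub>x(j)\<close>.  Since \<open>P\<^sub>0(\<tau> > 0) = 1\<close>, convolution with \<open>P\<^sub>0(\<tau> > \<cdot>)\<close> is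
  injective, so identities for survival probabilities descend to \<open>u\<close>, and by summation to \<open>V\<close>:
  the first exit from \<open>u + E\<close> gives (ii), and the first step gives \<open>p V = V - 1 + R\<close> for a
  constant \<open>R = \<Sum>\<^sub>j r\<^sub>j\<close> with \<open>R \<le> 1\<close>, and \<open>R = 1\<close> when the expected lifetime is infinite.  Thus \<open>V\<close> is
  superharmonic with \<open>V(0) = 1\<close>, hence finite by irreducibility, and this bounds the Green function
  of the ladder height process.  If \<open>R = 1\<close>, then \<open>P\<^sub>0(\<tau> > n + 1) / P\<^sub>0(\<tau> > n) \<rightarrow> 1\<close>, since the partial
  sums of \<open>R\<close> are lower bounds for this ratio; the lower bound \<open>V(x)\<close> for the liminf of
  \<open>P\<^sub>x(\<tau> > n) / P\<^sub>0(\<tau> > n)\<close> at all points, together with harmonicity, then forces convergence.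
\<close>

subsection \<open>Convolution of sequences\<close>

definition conv :: "(nat \<Rightarrow> ennreal) \<Rightarrow> (nat \<Rightarrow> ennreal) \<Rightarrow> nat \<Rightarrow> ennreal" where
  "conv f g n = (\<Sum>i\<le>n. f i * g (n - i))"

text \<open>Identifying convolution with the product of formal power series over
  \<open>ennreal\<close> makes associativity available for free.\<close>

lemma conv_eq_fps_nth: "conv f g n = fps_nth (Abs_fps f * Abs_fps g) n"
  by (simp add: conv_def fps_mult_nth atLeast0AtMost)

lemma conv_assoc: "conv (conv f g) h = conv f (conv g h)"
proof -
  have conv: "Abs_fps (conv f g) = Abs_fps f * Abs_fps g" for f g
    by (rule fps_ext) (simp add: conv_eq_fps_nth)
  show ?thesis
    by (rule ext) (simp add: conv_eq_fps_nth[of _ h] conv_eq_fps_nth[of f "conv g h"] conv mult.assoc)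
qed

lemma conv_0 [simp]: "conv f g 0 = f 0 * g 0"
  by (simp add: conv_def)

lemma conv_cong:
  "(\<And>i. i \<le> n \<Longrightarrow> f i = f' i) \<Longrightarrow> (\<And>i. i \<le> n \<Longrightarrow> g i = g' i) \<Longrightarrow> conv f g n = conv f' g' n"
  unfolding conv_def by (intro sum.cong) auto

lemma conv_add_left: "conv (\<lambda>i. f i + f' i) g n = conv f g n + conv f' g n"
  by (simp add: conv_def distrib_right sum.distrib)

lemma conv_Suc: "conv f g (Suc n) = f 0 * g (Suc n) + conv (\<lambda>i. f (Suc i)) g n"
  by (simp add: conv_def sum.atMost_Suc_shift del: sum.atMost_Suc)

text \<open>Tonelli on the index pairs \<open>(i, n)\<close>, each row being a shifted copy of
  \<open>g\<close>.\<close>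

lemma suminf_conv: "(\<Sum>n. conv f g n) = (\<Sum>n. f n) * (\<Sum>n. g n)"
proof -
  \<comment> \<open>Padding with zeros for \<open>i > n\<close> makes the range of \<open>i\<close>
    independent of \<open>n\<close>, so that the two sums can be exchanged.\<close>
  have conv: "conv f g n = (\<Sum>i. f i * (if i \<le> n then g (n - i) else 0))" for n
    by (subst suminf_finite[where N = "{..n}"]) (auto simp: conv_def)
  have shift: "(\<Sum>n. if i \<le> n then g (n - i) else 0) = (\<Sum>n. g n)" for i
    by (subst suminf_offset[where i = i]) auto
  have "(\<Sum>n. conv f g n) = (\<Sum>i. \<Sum>n. f i * (if i \<le> n then g (n - i) else 0))"
    unfolding conv nn_integral_count_space_nat[symmetric]
    by (rule nn_integral_count_space_nn_integral) auto
  then show ?thesis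
    unfolding ennreal_suminf_cmult shift by simp
qed

text \<open>For \<open>n < N\<close> only the values of \<open>g\<close> below \<open>N\<close>
  enter, so \<open>g\<close> may be cut off at \<open>N\<close> before the product formula is
  applied.\<close>

lemma sum_conv_le: "(\<Sum>n<N. conv f g n) \<le> (\<Sum>n. f n) * (\<Sum>n<N. g n)"
proof -
  let ?g = "\<lambda>n. if n < N then g n else 0"
  have "(\<Sum>n<N. conv f g n) = (\<Sum>n<N. conv f ?g n)"
    by (intro sum.cong conv_cong) auto
  also have "\<dots> \<le> (\<Sum>n. conv f ?g n)"
    by (rule sum_le_suminf) auto
  also have "\<dots> = (\<Sum>n. f n) * (\<Sum>n<N. g n)"
    by (subst suminf_conv, subst suminf_finite[where f = ?g and N = "{..<N}"]) auto
  finally show ?thesis .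
qed

text \<open>Since \<open>a 0 = 1\<close>, the value \<open>f n\<close> occurs in
  \<open>conv f a n\<close> with coefficient one, next to terms fixed by strong induction.
  Finiteness permits cancelling those terms in \<open>ennreal\<close>.\<close>

lemma conv_right_cancel:
  assumes eq: "\<And>n. conv f a n = conv g a n" and fin: "\<And>n. conv g a n < \<infinity>" and one: "a 0 = 1"
  shows "f n = g n"
proof (induction n rule: less_induct)
  case (less n)
  have split: "conv h a n = (\<Sum>i<n. h i * a (n - i)) + h n" for h
    unfolding conv_def using one by (simp flip: lessThan_Suc_atMost)
  have "(\<Sum>i<n. f i * a (n - i)) = (\<Sum>i<n. g i * a (n - i))"
    using less.IH by (intro sum.cong) auto
  moreover have "(\<Sum>i<n. g i * a (n - i)) \<noteq> \<infinity>"
    using fin[of n] unfolding split[of g] by (metis add_top_left_ennreal infinity_ennreal_def less_irrefl)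
  ultimately show ?case
    using eq[of n] unfolding split[of f] split[of g] by (simp add: ennreal_add_left_cancel)
qed

text \<open>Every factor \<open>a (n - i)\<close> is at least \<open>a n\<close>. This is the source
  of all lower bounds for ratios of survival probabilities.\<close>

lemma partial_sum_mult_le_conv:
  assumes "decseq a"
  shows "(\<Sum>i\<le>n. f i) * a n \<le> conv f a n"
  unfolding conv_def sum_distrib_right
  by (intro sum_mono mult_left_mono decseqD[OF assms]) auto

lemma conv_nn_integral:
  "conv (\<lambda>i. \<integral>\<^sup>+w. f w i \<partial>count_space A) g n = (\<integral>\<^sup>+w. conv (f w) g n \<partial>count_space A)"
  unfolding conv_def by (simp add: nn_integral_sum nn_integral_multc)

lemma conv_cmult_right: "c * conv f g n = conv (\<lambda>i. c * f i) g n"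
  by (simp add: conv_def sum_distrib_left mult.assoc)

subsection \<open>Powers of a kernel\<close>

lemma nn_integral_count_space_swap:
  fixes f :: "'a::countable \<Rightarrow> 'b \<Rightarrow> ennreal"
  shows "(\<integral>\<^sup>+x. \<integral>\<^sup>+y. f x y \<partial>count_space B \<partial>count_space A) =
    (\<integral>\<^sup>+y. \<integral>\<^sup>+x. f x y \<partial>count_space A \<partial>count_space B)"
  by (rule nn_integral_count_space_nn_integral[symmetric]) auto

lemma nn_integral_point_left:
  "x \<in> A \<Longrightarrow> (\<integral>\<^sup>+z. (if x = z then 1 else 0) * f z \<partial>count_space A) = (f x :: ennreal)"
  by (subst nn_integral_count_space'[where A = "{x}"]) auto

lemma nn_integral_point_right:
  "x \<in> A \<Longrightarrow> (\<integral>\<^sup>+z. f z * (if z = x then 1 else 0) \<partial>count_space A) = (f x :: ennreal)"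
  by (subst nn_integral_count_space'[where A = "{x}"]) auto

lemma nn_integral_remove_point:
  assumes "x \<in> A"
  shows "(\<integral>\<^sup>+z. f z \<partial>count_space A) = f x + (\<integral>\<^sup>+z. (if z = x then 0 else f z) \<partial>count_space A)"
proof -
  have "(\<integral>\<^sup>+z. f z \<partial>count_space A) =
      (\<integral>\<^sup>+z. f z * (if z = x then 1 else 0) + (if z = x then 0 else f z) \<partial>count_space A)"
    by (intro nn_integral_cong) auto
  then show ?thesis
    using assms by (simp add: nn_integral_add nn_integral_point_right)
qed

text \<open>The set is an argument because the same kernel is iterated both on \<open>E\<close> and,
  for walks that have not yet exited, on \<open>u + E\<close>.\<close>

primrec kernel_pow :: "'a set \<Rightarrow> ('a \<Rightarrow> 'a \<Rightarrow> ennreal) \<Rightarrow> nat \<Rightarrow> 'a \<Rightarrow> 'a \<Rightarrow> ennreal" where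
  "kernel_pow A p 0 x y = (if x = y then 1 else 0)"
| "kernel_pow A p (Suc n) x y = (\<integral>\<^sup>+z. p x z * kernel_pow A p n z y \<partial>count_space A)"

definition kernel_mass :: "'a set \<Rightarrow> ('a \<Rightarrow> 'a \<Rightarrow> ennreal) \<Rightarrow> nat \<Rightarrow> 'a \<Rightarrow> ennreal" where
  "kernel_mass A p n x = (\<integral>\<^sup>+y. kernel_pow A p n x y \<partial>count_space A)"

context
  fixes p :: "'a::countable \<Rightarrow> 'a \<Rightarrow> ennreal" and A :: "'a set"
begin

lemma kernel_pow_add:
  "x \<in> A \<Longrightarrow> kernel_pow A p (m + n) x y = (\<integral>\<^sup>+z. kernel_pow A p m x z * kernel_pow A p n z y \<partial>count_space A)"
proof (induction m arbitrary: x)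
  case (Suc m)
  have "kernel_pow A p (Suc m + n) x y =
      (\<integral>\<^sup>+z. \<integral>\<^sup>+w. p x z * (kernel_pow A p m z w * kernel_pow A p n w y) \<partial>count_space A \<partial>count_space A)"
    by (auto simp: Suc.IH nn_integral_cmult intro!: nn_integral_cong)
  also have "\<dots> = (\<integral>\<^sup>+w. kernel_pow A p (Suc m) x w * kernel_pow A p n w y \<partial>count_space A)"
    by (subst nn_integral_count_space_swap) (simp add: nn_integral_multc mult.assoc[symmetric])
  finally show ?case .
qed (simp add: nn_integral_point_left)

text \<open>The recursion peels off the first step, whereas path probabilities are computed by
  appending a last step.\<close>

lemma kernel_pow_Suc_last:
  "x \<in> A \<Longrightarrow> y \<in> A \<Longrightarrow> kernel_pow A p (Suc n) x y = (\<integral>\<^sup>+z. kernel_pow A p n x z * p z y \<partial>count_space A)"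
  using kernel_pow_add[of x n 1 y] by (simp add: nn_integral_point_right)

lemma kernel_mass_0 [simp]: "x \<in> A \<Longrightarrow> kernel_mass A p 0 x = 1"
  using nn_integral_point_left[of x A "\<lambda>_. 1"] by (simp add: kernel_mass_def)

lemma kernel_mass_add:
  assumes "x \<in> A"
  shows "kernel_mass A p (m + n) x = (\<integral>\<^sup>+z. kernel_pow A p m x z * kernel_mass A p n z \<partial>count_space A)"
proof -
  have "kernel_mass A p (m + n) x =
      (\<integral>\<^sup>+y. \<integral>\<^sup>+z. kernel_pow A p m x z * kernel_pow A p n z y \<partial>count_space A \<partial>count_space A)"
    unfolding kernel_mass_def by (intro nn_integral_cong kernel_pow_add assms)
  also have "\<dots> = (\<integral>\<^sup>+z. \<integral>\<^sup>+y. kernel_pow A p m x z * kernel_pow A p n z y \<partial>count_space A \<partial>count_space A)"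
    by (rule nn_integral_count_space_swap)
  finally show ?thesis
    by (simp add: nn_integral_cmult kernel_mass_def)
qed

lemma kernel_mass_Suc:
  "kernel_mass A p (Suc n) x = (\<integral>\<^sup>+z. p x z * kernel_mass A p n z \<partial>count_space A)"
  unfolding kernel_mass_def kernel_pow.simps
  by (simp add: nn_integral_cmult[symmetric]) (rule nn_integral_count_space_swap)

lemma suminf_kernel_mass:
  "(\<Sum>n. kernel_mass A p n x) = (\<integral>\<^sup>+y. (\<Sum>n. kernel_pow A p n x y) \<partial>count_space A)"
  unfolding kernel_mass_def by (rule nn_integral_suminf[symmetric]) simp

end

subsection \<open>Paths of the chain\<close>

lemma chain_law_coordinate_sets [measurable]:
  "{\<omega>. Q (\<omega> n)} \<in> sets (chain_law K x)" for K :: "'s::countable \<Rightarrow> 's pmf"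
proof -
  have "{\<omega>. Q (\<omega> n)} = (\<Union>s\<in>{s. Q s}. {\<omega>. \<omega> n = s})" by auto
  then show ?thesis
    using sets_chain_coordinate by (auto intro!: sets.countable_UN'')
qed

lemma chain_law_stay_sets:
  "{\<omega>. (\<forall>i\<le>n. \<omega> i \<in> A) \<and> Q (\<omega> m) \<and> R (\<omega> k)} \<in> sets (chain_law K x)"
  for K :: "'s::countable \<Rightarrow> 's pmf"
proof -
  have "{\<omega>. (\<forall>i\<le>n. \<omega> i \<in> A) \<and> Q (\<omega> m) \<and> R (\<omega> k)} =
      (\<Inter>i\<in>{..n}. {\<omega>. \<omega> i \<in> A}) \<inter> {\<omega>. Q (\<omega> m)} \<inter> {\<omega>. R (\<omega> k)}" by auto
  then show ?thesis
    using chain_law_coordinate_sets by (auto intro!: sets.Int sets.finite_INT)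
qed

text \<open>Markov property under confinement to \<open>A\<close>: the event is a countable disjoint
  union of cylinders, one for each list of states in \<open>A\<close> ending in \<open>y\<close>,
  and each cylinder acquires the same last factor.\<close>

lemma chain_law_step_stay:
  fixes K :: "'s::countable \<Rightarrow> 's pmf"
  shows "emeasure (chain_law K x) {\<omega>. (\<forall>i\<le>n. \<omega> i \<in> A) \<and> \<omega> n = y \<and> \<omega> (Suc n) = z} =
    emeasure (chain_law K x) {\<omega>. (\<forall>i\<le>n. \<omega> i \<in> A) \<and> \<omega> n = y} * ennreal (pmf (K y) z)"
proof -
  let ?P = "chain_law K x"
  let ?cyl = "\<lambda>l z. {\<omega>. \<forall>i\<le>Suc n. \<omega> i = (l @ [z]) ! i}"
  let ?past = "\<lambda>l. {\<omega>. \<forall>i\<le>n. \<omega> i = l ! i}"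
  define I where "I = {l. length l = Suc n \<and> l ! n = y \<and> set l \<subseteq> A}"
  have past: "(\<forall>i\<le>n. \<omega> i = l ! i) \<longleftrightarrow> map \<omega> [0..<Suc n] = l" if "l \<in> I" for \<omega> l
    using that by (auto simp: I_def list_eq_iff_nth_eq less_Suc_eq_le simp del: upt_Suc)
  have mem: "map \<omega> [0..<Suc n] \<in> I \<longleftrightarrow> (\<forall>i\<le>n. \<omega> i \<in> A) \<and> \<omega> n = y" for \<omega>
    by (auto simp: I_def less_Suc_eq_le nth_append image_subset_iff simp del: upt_Suc)
  \<comment> \<open>The set \<open>B\<close> is kept general so that \<open>{z}\<close> and
    \<open>UNIV\<close> give the two sides of the claim.\<close>
  have split: "emeasure ?P {\<omega>. ((\<forall>i\<le>n. \<omega> i \<in> A) \<and> \<omega> n = y) \<and> \<omega> (Suc n) \<in> B} =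
      (\<integral>\<^sup>+l. emeasure ?P (?past l \<inter> {\<omega>. \<omega> (Suc n) \<in> B}) \<partial>count_space I)" for B
  proof -
    have "{\<omega>. ((\<forall>i\<le>n. \<omega> i \<in> A) \<and> \<omega> n = y) \<and> \<omega> (Suc n) \<in> B} =
        (\<Union>l\<in>I. ?past l \<inter> {\<omega>. \<omega> (Suc n) \<in> B})"
      using past mem by fastforce
    moreover have "disjoint_family_on (\<lambda>l. ?past l \<inter> {\<omega>. \<omega> (Suc n) \<in> B}) I"
      using past by (fastforce simp: disjoint_family_on_def)
    moreover have "?past l \<inter> {\<omega>. \<omega> (Suc n) \<in> B} \<in> sets ?P" for l
      using sets_chain_cylinder[of n "\<lambda>i. l ! i"] chain_law_coordinate_sets[of "\<lambda>s. s \<in> B" "Suc n" K x]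
      by auto
    ultimately show ?thesis
      by (simp only: emeasure_UN_countable countableI_type)
  qed
  have "emeasure ?P (?past l \<inter> {\<omega>. \<omega> (Suc n) \<in> {z}}) = emeasure ?P (?past l) * ennreal (pmf (K y) z)"
    if "l \<in> I" for l
  proof -
    have now: "?past l \<inter> {\<omega>. \<omega> (Suc n) \<in> {z}} = ?cyl l z"
      using that by (auto simp: I_def le_Suc_eq nth_append)
    have past: "?past l = {\<omega>. \<forall>i\<le>n. \<omega> i = (l @ [z]) ! i}"
      using that by (auto simp: I_def nth_append)
    have "(l @ [z]) ! n = y" "(l @ [z]) ! Suc n = z"
      using that by (auto simp: I_def nth_append)
    then show ?thesis
      by (subst now, subst past) (simp add: chain_law_cylinder)
  qed
  then show ?thesis
    using split[of "{z}"] split[of UNIV]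
    by (simp add: nn_integral_multc conj_assoc cong: nn_integral_cong_simp)
qed

lemma AE_chain_law_start: "AE \<omega> in chain_law K x. \<omega> 0 = x" for K :: "'s::countable \<Rightarrow> 's pmf"
proof -
  interpret prob_space "chain_law K x" by (rule prob_space_chain_law)
  have "emeasure (chain_law K x) {\<omega>. \<omega> 0 = x} = 1"
    using chain_law_cylinder[of K x 0 "\<lambda>_. x"] by simp
  then show ?thesis
    using chain_law_coordinate_sets[of "\<lambda>s. s = x" 0 K x] by (intro AE_I_eq_1) auto
qed

text \<open>There are only countably many forbidden transitions \<open>(n, s, t)\<close>, each of
  probability zero.\<close>

lemma AE_chain_law_step:
  fixes K :: "'s::countable \<Rightarrow> 's pmf"
  shows "AE \<omega> in chain_law K x. \<forall>n. \<omega> (Suc n) \<in> set_pmf (K (\<omega> n))"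
proof -
  have "AE \<omega> in chain_law K x. \<forall>n s t. t \<notin> set_pmf (K s) \<longrightarrow> \<not> (\<omega> n = s \<and> \<omega> (Suc n) = t)"
    unfolding AE_all_countable
  proof (intro allI AE_impI)
    fix n s t assume "t \<notin> set_pmf (K s)"
    then have "emeasure (chain_law K x) {\<omega>. \<omega> n = s \<and> \<omega> (Suc n) = t} = 0"
      by (simp add: chain_law_step set_pmf_iff)
    then show "AE \<omega> in chain_law K x. \<not> (\<omega> n = s \<and> \<omega> (Suc n) = t)"
      using chain_law_stay_sets[of 0 UNIV "\<lambda>w. w = s" n "\<lambda>w. w = t" "Suc n" K x]
      by (intro AE_I[where N = "{\<omega>. \<omega> n = s \<and> \<omega> (Suc n) = t}"]) auto
  qed
  then show ?thesis
    by (rule eventually_mono) blast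
qed

subsection \<open>The killed chain\<close>

lemma first_time_eqI:
  assumes "m > 0" "Q m" "\<And>i. 0 < i \<Longrightarrow> i < m \<Longrightarrow> \<not> Q i"
  shows "first_time Q = enat m"
  unfolding first_time_def using assms
  by (intro antisym INF_lower INF_greatest) (auto simp: not_less[symmetric])

text \<open>The range starts at 1 because \<open>first_time\<close> ignores time 0; for
  \<open>n = 0\<close> this says that first times are positive.\<close>

lemma enat_less_first_time_iff: "enat n < first_time Q \<longleftrightarrow> (\<forall>i\<in>{1..n}. \<not> Q i)"
proof -
  have "enat n < first_time Q \<longleftrightarrow> enat (Suc n) \<le> first_time Q"
    by (simp add: Suc_ile_eq)
  also have "\<dots> \<longleftrightarrow> (\<forall>i\<in>{1..n}. \<not> Q i)"
    unfolding first_time_def le_INF_iff by (auto simp: not_less_eq_eq[symmetric] Suc_le_eq)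
  finally show ?thesis .
qed

lemma first_time_eq_Suc_iff:
  "first_time Q = enat (Suc n) \<longleftrightarrow> Q (Suc n) \<and> (\<forall>i\<in>{1..n}. \<not> Q i)"
proof
  assume T: "first_time Q = enat (Suc n)"
  then have "\<forall>i\<in>{1..n}. \<not> Q i" and "\<not> (\<forall>i\<in>{1..Suc n}. \<not> Q i)"
    unfolding enat_less_first_time_iff[symmetric] by auto
  then show "Q (Suc n) \<and> (\<forall>i\<in>{1..n}. \<not> Q i)"
    by (auto simp: atLeastAtMostSuc_conv)
next
  assume "Q (Suc n) \<and> (\<forall>i\<in>{1..n}. \<not> Q i)"
  then show "first_time Q = enat (Suc n)"
    by (intro first_time_eqI) auto
qed

lemma first_time_positive: "first_time Q \<noteq> 0"
  using enat_less_first_time_iff[of 0 Q] by (auto simp: enat_0)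

text \<open>Pathwise form of the tail-sum formula, which turns expected lifetimes into sums of
  survival probabilities.\<close>

lemma ennreal_of_enat_eq_suminf:
  "ennreal_of_enat a = (\<Sum>n. if enat n < a then 1 else 0)"
proof (cases a)
  case (enat k)
  then show ?thesis
    by (subst suminf_finite[where N = "{..<k}"]) auto
next
  case infinity
  have "(\<Sum>n. 1 :: ennreal) = \<infinity>"
    using nn_integral_count_space_nat[of "\<lambda>_. 1"] by simp
  with infinity show ?thesis by simp
qed

context
  fixes p :: "'a::countable \<Rightarrow> 'a \<Rightarrow> ennreal" and E :: "'a set"
  assumes sub: "\<And>x. (\<integral>\<^sup>+y. p x y \<partial>count_space E) \<le> 1"
begin

abbreviation (input) "killed_law x \<equiv> chain_law (cemetery_kernel E p) (Some x)"

text \<open>Induction on the last position. Taking \<open>A = E\<close> yields the one-time laws,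
  and taking \<open>A\<close> to be a shifted copy of \<open>E\<close> yields the law before an
  exit.\<close>

lemma emeasure_killed_stay:
  assumes "A \<subseteq> E" "x \<in> A" "y \<in> A"
  shows "emeasure (killed_law x) {\<omega>. (\<forall>i\<le>n. \<omega> i \<in> Some ` A) \<and> \<omega> n = Some y} = kernel_pow A p n x y"
  using \<open>y \<in> A\<close>
proof (induction n arbitrary: y)
  case 0
  have start: "{\<omega>. (\<forall>i\<le>0. \<omega> i \<in> Some ` A) \<and> \<omega> 0 = Some y} = {\<omega>. \<forall>i\<le>(0::nat). \<omega> i = Some y}"
    using 0 by auto
  show ?case
    unfolding start using chain_law_cylinder[of _ "Some x" 0 "\<lambda>_. Some y"] by simp
next
  case (Suc n)
  let ?F = "\<lambda>z. {\<omega>. (\<forall>i\<le>n. \<omega> i \<in> Some ` A) \<and> \<omega> n = Some z \<and> \<omega> (Suc n) = Some y}"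
  have now: "{\<omega>. (\<forall>i\<le>Suc n. \<omega> i \<in> Some ` A) \<and> \<omega> (Suc n) = Some y} = (\<Union>z\<in>A. ?F z)"
  proof (intro set_eqI iffI)
    fix \<omega> assume \<omega>: "\<omega> \<in> {\<omega>. (\<forall>i\<le>Suc n. \<omega> i \<in> Some ` A) \<and> \<omega> (Suc n) = Some y}"
    then have "\<omega> n \<in> Some ` A" by simp
    then obtain z where "z \<in> A" "\<omega> n = Some z" by auto
    with \<omega> show "\<omega> \<in> (\<Union>z\<in>A. ?F z)" by auto
  qed (use Suc.prems in \<open>auto simp: le_Suc_eq\<close>)
  have "emeasure (killed_law x) (\<Union>z\<in>A. ?F z) = (\<integral>\<^sup>+z. emeasure (killed_law x) (?F z) \<partial>count_space A)"
  proof (rule emeasure_UN_countable)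
    show "?F z \<in> sets (killed_law x)" for z by (rule chain_law_stay_sets)
  qed (auto simp: disjoint_family_on_def)
  also have "\<dots> = (\<integral>\<^sup>+z. kernel_pow A p n x z * p z y \<partial>count_space A)"
    using Suc.prems assms(1)
    by (intro nn_integral_cong)
       (auto simp: chain_law_step_stay Suc.IH pmf_cemetery_kernel(1)[OF sub])
  also have "\<dots> = kernel_pow A p (Suc n) x y"
    using assms Suc.prems by (intro kernel_pow_Suc_last[symmetric]) auto
  finally show ?case
    unfolding now .
qed

text \<open>The state space contains \<open>Some y\<close> for every \<open>y\<close>, but the
  kernel gives no mass to points outside \<open>E\<close>, and the cemetery is absorbing.\<close>

lemma AE_killed:
  assumes "x \<in> E"
  shows "AE \<omega> in killed_law x. \<omega> 0 = Some x \<and> (\<forall>n. \<omega> n = None \<or> \<omega> n \<in> Some ` E) \<and>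
    (\<forall>n. \<omega> n = None \<longrightarrow> \<omega> (Suc n) = None)"
  using AE_chain_law_start AE_chain_law_step
proof eventually_elim
  case (elim \<omega>)
  have None: "\<omega> (Suc n) = None" if "\<omega> n = None" for n
    using elim(2)[rule_format, of n] that by (simp add: cemetery_kernel_def)
  have "\<omega> n = None \<or> \<omega> n \<in> Some ` E" for n
  proof (cases n)
    case (Suc m)
    have "y \<in> E" if "\<omega> m = Some z" "\<omega> (Suc m) = Some y" for z y
      using elim(2)[rule_format, of m] that pmf_cemetery_kernel(2)[where p = p and x = z and y = y, OF sub]
      by (auto simp: set_pmf_iff)
    then show ?thesis
      using None[of m] Suc by (cases "\<omega> m"; cases "\<omega> n") auto
  qed (use elim assms in auto)
  with None elim show ?case by blast
qed

text \<open>Absorption makes being in \<open>E\<close> at time \<open>n\<close> equivalent to having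
  been there at all earlier times. Time 0, which \<open>lifetime\<close> ignores, is settled by the
  starting point.\<close>

lemma AE_killed_alive:
  assumes "x \<in> E"
  shows "AE \<omega> in killed_law x. \<forall>n. (\<omega> n \<in> Some ` E \<longleftrightarrow> (\<forall>i\<le>n. \<omega> i \<in> Some ` E)) \<and>
    (enat n < lifetime \<omega> \<longleftrightarrow> \<omega> n \<in> Some ` E)"
  using AE_killed[OF assms]
proof eventually_elim
  case (elim \<omega>)
  have None: "\<omega> n = None" if "i \<le> n" "\<omega> i = None" for i n
    using that by (induction rule: dec_induct) (use elim in auto)
  have Some: "\<omega> n \<in> Some ` E \<longleftrightarrow> \<omega> n \<noteq> None" for n
    using elim[THEN conjunct2, THEN conjunct1, rule_format, of n] by (elim disjE imageE) auto
  show ?case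
    unfolding Some lifetime_def enat_less_first_time_iff
  proof (rule allI, rule conjI)
    fix n
    show "\<omega> n \<noteq> None \<longleftrightarrow> (\<forall>i\<le>n. \<omega> i \<noteq> None)"
      using None[of _ n] by (metis order_refl)
    have "\<omega> n \<noteq> None" if "\<forall>i\<in>{1..n}. \<omega> i \<noteq> None"
      using that elim[THEN conjunct1] by (cases n) simp_all
    then show "(\<forall>i\<in>{1..n}. \<omega> i \<noteq> None) \<longleftrightarrow> \<omega> n \<noteq> None"
      using None[of _ n] by (metis atLeastAtMost_iff)
  qed
qed

lemma emeasure_killed_at:
  assumes "x \<in> E" "y \<in> E"
  shows "emeasure (killed_law x) {\<omega>. \<omega> n = Some y} = kernel_pow E p n x y"
proof -
  have "emeasure (killed_law x) {\<omega>. \<omega> n = Some y} =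
      emeasure (killed_law x) {\<omega>. (\<forall>i\<le>n. \<omega> i \<in> Some ` E) \<and> \<omega> n = Some y}"
  proof (rule emeasure_eq_AE)
    show "AE \<omega> in killed_law x. \<omega> \<in> {\<omega>. \<omega> n = Some y} \<longleftrightarrow>
        \<omega> \<in> {\<omega>. (\<forall>i\<le>n. \<omega> i \<in> Some ` E) \<and> \<omega> n = Some y}"
      using AE_killed_alive[OF assms(1)]
    proof eventually_elim
      case (elim \<omega>)
      show ?case
        using elim[THEN spec, THEN conjunct1, of n] assms(2) by (cases "\<omega> n = Some y") simp_all
    qed
    show "{\<omega>. (\<forall>i\<le>n. \<omega> i \<in> Some ` E) \<and> \<omega> n = Some y} \<in> sets (killed_law x)"
      using chain_law_stay_sets[of n "Some ` E" "\<lambda>w. w = Some y" n "\<lambda>_. True" n] by simp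
  qed (rule chain_law_coordinate_sets)
  then show ?thesis
    using emeasure_killed_stay[OF order_refl assms] by simp
qed

lemma green_killed:
  "x \<in> E \<Longrightarrow> y \<in> E \<Longrightarrow> green killed_law x y = (\<Sum>n. kernel_pow E p n x y)"
  by (simp add: green_def emeasure_killed_at)

lemma lifetime_gt_sets: "{\<omega>. enat n < lifetime \<omega>} \<in> sets (killed_law x)"
proof -
  have "{\<omega>. enat n < lifetime \<omega>} = (\<Inter>i\<in>{1..n}. {\<omega>. \<omega> i \<noteq> None}) \<inter> UNIV"
    by (auto simp: lifetime_def enat_less_first_time_iff)
  also have "\<dots> \<in> sets (killed_law x)"
    using sets.top[of "killed_law x"] chain_law_coordinate_sets[of "\<lambda>s. s \<noteq> None"]
    by (cases n) (auto intro!: sets.Int sets.finite_INT)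
  finally show ?thesis .
qed

lemma survival_killed:
  assumes "x \<in> E"
  shows "survival killed_law x n = kernel_mass E p n x"
proof -
  have "survival killed_law x n = emeasure (killed_law x) (\<Union>y\<in>E. {\<omega>. \<omega> n = Some y})"
    unfolding survival_def
  proof (rule emeasure_eq_AE)
    show "AE \<omega> in killed_law x. \<omega> \<in> {\<omega>. enat n < lifetime \<omega>} \<longleftrightarrow> \<omega> \<in> (\<Union>y\<in>E. {\<omega>. \<omega> n = Some y})"
      using AE_killed_alive[OF assms]
    proof eventually_elim
      case (elim \<omega>)
      show ?case
        using elim[THEN spec, THEN conjunct2, of n] by (simp add: image_iff)
    qed
    show "(\<Union>y\<in>E. {\<omega>. \<omega> n = Some y}) \<in> sets (killed_law x)"
      by (intro sets.countable_UN'' chain_law_coordinate_sets countableI_type)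
  qed (rule lifetime_gt_sets)
  also have "\<dots> = (\<integral>\<^sup>+y. emeasure (killed_law x) {\<omega>. \<omega> n = Some y} \<partial>count_space E)"
    by (intro emeasure_UN_countable chain_law_coordinate_sets countableI_type)
       (auto simp: disjoint_family_on_def)
  also have "\<dots> = kernel_mass E p n x"
    unfolding kernel_mass_def using assms by (intro nn_integral_cong) (simp add: emeasure_killed_at)
  finally show ?thesis .
qed

lemma expected_lifetime_killed:
  assumes "x \<in> E"
  shows "expected_lifetime killed_law x = (\<Sum>n. kernel_mass E p n x)"
proof -
  have [measurable]: "{\<omega>. enat n < lifetime \<omega>} \<in> sets (killed_law x)" for n
    by (rule lifetime_gt_sets)
  have "expected_lifetime killed_law x =
      (\<integral>\<^sup>+\<omega>. (\<Sum>n. indicator {\<omega>. enat n < lifetime \<omega>} \<omega>) \<partial>killed_law x)"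
    unfolding expected_lifetime_def
    by (intro nn_integral_cong) (simp add: ennreal_of_enat_eq_suminf indicator_def of_bool_def)
  also have "\<dots> = (\<Sum>n. survival killed_law x n)"
    unfolding survival_def by (subst nn_integral_suminf) (simp_all add: lifetime_gt_sets del: sets_chain_law)
  finally have "expected_lifetime killed_law x = (\<Sum>n. survival killed_law x n)" .
  then show ?thesis by (simp add: survival_killed assms)
qed

end

subsection \<open>Walks in a semigroup\<close>

text \<open>The argument is carried out for a translation invariant kernel on a countable abelian
  group; the measure \<open>\<mu>\<close> returns only when the final theorem instantiates the
  locale.\<close>

locale semigroup_walk =
  fixes p :: "'a::{countable, ab_group_add} \<Rightarrow> 'a \<Rightarrow> ennreal" and E :: "'a set"
  assumes substochastic: "\<And>x. (\<integral>\<^sup>+y. p x y \<partial>count_space E) \<le> 1"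
    and invariant: "\<And>u x y. p (u + x) (u + y) = p x y"
    and zero_mem: "0 \<in> E"
    and add_mem: "\<And>x u. x \<in> E \<Longrightarrow> u \<in> E \<Longrightarrow> u + x \<in> E"
begin

abbreviation pow :: "nat \<Rightarrow> 'a \<Rightarrow> 'a \<Rightarrow> ennreal" where "pow \<equiv> kernel_pow E p"

abbreviation mass :: "nat \<Rightarrow> 'a \<Rightarrow> ennreal" where "mass \<equiv> kernel_mass E p"

text \<open>The probability that the walk started at \<open>u + x\<close> leaves \<open>u + E\<close> at time \<open>n + 1\<close> and at \<open>w\<close>.\<close>

definition exit_kernel :: "nat \<Rightarrow> 'a \<Rightarrow> 'a \<Rightarrow> 'a \<Rightarrow> ennreal" where
  "exit_kernel n x u w =
     (if w \<in> E - (+) u ` E then \<integral>\<^sup>+z. pow n x z * p (u + z) w \<partial>count_space E else 0)"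

lemma exit_kernel_0:
  "x \<in> E \<Longrightarrow> exit_kernel 0 x u w = (if w \<in> E - (+) u ` E then p (u + x) w else 0)"
  by (simp add: exit_kernel_def nn_integral_point_left)

lemma exit_kernel_Suc:
  "exit_kernel (Suc n) x u w = (\<integral>\<^sup>+z. p x z * exit_kernel n z u w \<partial>count_space E)"
proof (cases "w \<in> E - (+) u ` E")
  case True
  then have "exit_kernel (Suc n) x u w =
      (\<integral>\<^sup>+y. \<integral>\<^sup>+z. p x z * (pow n z y * p (u + y) w) \<partial>count_space E \<partial>count_space E)"
    by (simp add: exit_kernel_def nn_integral_multc mult.assoc[symmetric])
  also have "\<dots> = (\<integral>\<^sup>+z. \<integral>\<^sup>+y. p x z * (pow n z y * p (u + y) w) \<partial>count_space E \<partial>count_space E)"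
    by (rule nn_integral_count_space_swap)
  finally show ?thesis
    using True by (simp add: exit_kernel_def nn_integral_cmult)
next
  case False
  then have "exit_kernel m z u w = 0" for m z
    unfolding exit_kernel_def by (rule if_not_P)
  then show ?thesis by simp
qed

section \<open>Survival from a shifted starting point\<close>

lemma nn_integral_split_shift:
  assumes "u \<in> E"
  shows "(\<integral>\<^sup>+v. f v \<partial>count_space E) = (\<integral>\<^sup>+z. f (u + z) \<partial>count_space E) +
    (\<integral>\<^sup>+w. (if w \<in> E - (+) u ` E then f w else 0) \<partial>count_space E)"
proof -
  have "(+) u ` E \<subseteq> E"
    using assms add_mem by auto
  then have "(\<integral>\<^sup>+v. f v \<partial>count_space E) =
      (\<integral>\<^sup>+v. f v * indicator ((+) u ` E) v + (if v \<in> E - (+) u ` E then f v else 0) \<partial>count_space E)"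
    by (intro nn_integral_cong) (auto split: split_indicator)
  also have "\<dots> = (\<integral>\<^sup>+v. f v * indicator ((+) u ` E) v \<partial>count_space E) +
      (\<integral>\<^sup>+w. (if w \<in> E - (+) u ` E then f w else 0) \<partial>count_space E)"
    by (rule nn_integral_add) auto
  also have "(\<integral>\<^sup>+v. f v * indicator ((+) u ` E) v \<partial>count_space E) = (\<integral>\<^sup>+v. f v \<partial>count_space ((+) u ` E))"
    using assms
    by (auto simp: nn_integral_count_space_indicator add_mem intro!: nn_integral_cong split: split_indicator)
  also have "\<dots> = (\<integral>\<^sup>+z. f (u + z) \<partial>count_space E)"
    by (rule nn_integral_bij_count_space[symmetric]) (auto intro: bij_betw_imageI)
  finally show ?thesis .
qed

text \<open>Either the walk never leaves \<open>u + E\<close>, which by translation has the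
  probability of survival from \<open>x\<close>, or it first leaves at time \<open>i + 1\<close> to
  some \<open>w\<close> in \<open>E\<close> and survives \<open>n - i\<close> further steps from
  \<open>w\<close>.\<close>

lemma mass_Suc_add:
  "x \<in> E \<Longrightarrow> u \<in> E \<Longrightarrow> mass (Suc n) (u + x) =
     mass (Suc n) x + (\<integral>\<^sup>+w. conv (\<lambda>i. exit_kernel i x u w) (\<lambda>j. mass j w) n \<partial>count_space E)"
proof (induction n arbitrary: x)
  \<comment> \<open>A first step into \<open>u + E\<close> reproduces the situation with
    \<open>x\<close> replaced by \<open>z\<close>; any other step within \<open>E\<close> is an exit
    at time 1, the term \<open>i = 0\<close>.\<close>
  have step: "mass (Suc n) (u + x) = (\<integral>\<^sup>+z. p x z * mass n (u + z) \<partial>count_space E) +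
      (\<integral>\<^sup>+w. exit_kernel 0 x u w * mass n w \<partial>count_space E)" if "x \<in> E" "u \<in> E" for n x
  proof -
    have "(\<integral>\<^sup>+w. exit_kernel 0 x u w * mass n w \<partial>count_space E) =
        (\<integral>\<^sup>+w. (if w \<in> E - (+) u ` E then p (u + x) w * mass n w else 0) \<partial>count_space E)"
      using that by (intro nn_integral_cong) (simp add: exit_kernel_0)
    then show ?thesis
      unfolding kernel_mass_Suc by (subst nn_integral_split_shift[OF that(2)]) (simp add: invariant)
  qed
  {
    case 0
    have "mass 0 (u + z) = mass 0 z" if "z \<in> E" for z
      using that 0 add_mem by simp
    then have "(\<integral>\<^sup>+z. p x z * mass 0 (u + z) \<partial>count_space E) = mass (Suc 0) x"
      unfolding kernel_mass_Suc by (intro nn_integral_cong) simp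
    with 0 show ?case by (simp add: step)
  next
    case (Suc n)
    let ?c = "\<lambda>x w. conv (\<lambda>i. exit_kernel i x u w) (\<lambda>j. mass j w)"
    have "(\<integral>\<^sup>+z. p x z * mass (Suc n) (u + z) \<partial>count_space E) =
        (\<integral>\<^sup>+z. p x z * mass (Suc n) z + p x z * (\<integral>\<^sup>+w. ?c z w n \<partial>count_space E) \<partial>count_space E)"
      using Suc by (intro nn_integral_cong) (simp add: distrib_left)
    also have "\<dots> = mass (Suc (Suc n)) x +
        (\<integral>\<^sup>+z. \<integral>\<^sup>+w. p x z * ?c z w n \<partial>count_space E \<partial>count_space E)"
      by (simp add: nn_integral_add nn_integral_cmult kernel_mass_Suc[of _ _ "Suc n"])
    also have "(\<integral>\<^sup>+z. \<integral>\<^sup>+w. p x z * ?c z w n \<partial>count_space E \<partial>count_space E) =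
        (\<integral>\<^sup>+w. \<integral>\<^sup>+z. p x z * ?c z w n \<partial>count_space E \<partial>count_space E)"
      by (rule nn_integral_count_space_swap)
    also have "\<dots> = (\<integral>\<^sup>+w. conv (\<lambda>i. exit_kernel (Suc i) x u w) (\<lambda>j. mass j w) n \<partial>count_space E)"
      by (simp add: exit_kernel_Suc conv_nn_integral conv_cmult_right)
    finally show ?case
      using Suc.prems
      by (simp add: step[of _ "Suc n"] conv_Suc nn_integral_add add.assoc)
  }
qed

lemma mass_le_1: "x \<in> E \<Longrightarrow> mass n x \<le> 1"
proof (induction n arbitrary: x)
  case (Suc n)
  have "mass (Suc n) x \<le> (\<integral>\<^sup>+z. p x z * 1 \<partial>count_space E)"
    unfolding kernel_mass_Suc using Suc.IH by (intro nn_integral_mono mult_left_mono) auto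
  then show ?case
    using substochastic[of x] by simp
qed simp

text \<open>The extra step is appended at the end, where it contributes a factor
  \<open>mass 1 z\<close>, at most 1.\<close>

lemma mass_Suc_le:
  assumes "x \<in> E"
  shows "mass (Suc n) x \<le> mass n x"
proof -
  have "mass (n + 1) x \<le> mass (n + 0) x"
    unfolding kernel_mass_add[OF assms] using mass_le_1[of _ 1]
    by (intro nn_integral_mono mult_left_mono) auto
  then show ?thesis by simp
qed

lemma decseq_mass: "x \<in> E \<Longrightarrow> decseq (\<lambda>n. mass n x)"
  by (intro decseq_SucI mass_Suc_le)

subsection \<open>The renewal sequence of ladder times\<close>

text \<open>The probability that \<open>n\<close> is a ladder time before the lifetime of the walk started at \<open>x\<close>.\<close>

fun renewal :: "nat \<Rightarrow> 'a \<Rightarrow> ennreal" where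
  "renewal 0 x = 1"
| "renewal (Suc n) x = (\<integral>\<^sup>+w. (\<Sum>i\<le>n. exit_kernel i 0 x w * renewal (n - i) w) \<partial>count_space E)"

text \<open>The recursive equation spells the sum out because the decreasing argument
  \<open>n - i\<close> has to be visible for termination; all later work uses the
  convolution.\<close>

lemma renewal_Suc:
  "renewal (Suc n) x = (\<integral>\<^sup>+w. conv (\<lambda>i. exit_kernel i 0 x w) (\<lambda>j. renewal j w) n \<partial>count_space E)"
  by (simp add: conv_def)

declare renewal.simps(2) [simp del]

text \<open>Until its first exit from \<open>x + E\<close> the walk from \<open>x\<close> is a
  translate of the walk from \<open>0\<close>. Strong induction applies from the exit point on,
  where less time remains, and associativity reassembles the renewal recursion.\<close>

lemma mass_eq_conv_renewal:
  "x \<in> E \<Longrightarrow> mass n x = conv (\<lambda>j. renewal j x) (\<lambda>j. mass j 0) n"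
proof (induction n arbitrary: x rule: less_induct)
  case (less n)
  show ?case
  proof (cases n)
    case 0
    with less.prems zero_mem show ?thesis by simp
  next
    case (Suc m)
    have "mass (Suc m) x = mass (Suc m) 0 +
        (\<integral>\<^sup>+w. conv (\<lambda>i. exit_kernel i 0 x w) (\<lambda>j. mass j w) m \<partial>count_space E)"
      using mass_Suc_add[OF zero_mem less.prems, of m] by simp
    also have "(\<integral>\<^sup>+w. conv (\<lambda>i. exit_kernel i 0 x w) (\<lambda>j. mass j w) m \<partial>count_space E) =
        (\<integral>\<^sup>+w. conv (\<lambda>i. exit_kernel i 0 x w) (conv (\<lambda>j. renewal j w) (\<lambda>j. mass j 0)) m \<partial>count_space E)"
      using Suc less.IH by (intro nn_integral_cong conv_cong) auto
    also have "\<dots> = conv (\<lambda>i. renewal (Suc i) x) (\<lambda>j. mass j 0) m"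
      by (simp add: renewal_Suc conv_nn_integral conv_assoc)
    finally show ?thesis
      using Suc by (simp add: conv_Suc)
  qed
qed

lemma conv_renewal_finite: "x \<in> E \<Longrightarrow> conv (\<lambda>j. renewal j x) (\<lambda>j. mass j 0) n < \<infinity>"
  using mass_le_1[of x n] by (simp flip: mass_eq_conv_renewal add: le_less_trans)

text \<open>Convolved with the survival sequence of \<open>0\<close>, both sides become those of
  \<open>mass_Suc_add\<close>, so the cancellation lemma applies. The value 0 at
  \<open>n = 0\<close> reflects that an exit takes at least one step.\<close>

lemma renewal_add:
  assumes "x \<in> E" "u \<in> E"
  shows "renewal n (u + x) = renewal n x + (case n of 0 \<Rightarrow> 0
    | Suc m \<Rightarrow> \<integral>\<^sup>+w. conv (\<lambda>i. exit_kernel i x u w) (\<lambda>j. renewal j w) m \<partial>count_space E)"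
    (is "_ = _ + ?S n")
proof (rule sym, rule conv_right_cancel[where a = "\<lambda>j. mass j 0"])
  have S: "conv ?S (\<lambda>j. mass j 0) (Suc m) =
      (\<integral>\<^sup>+w. conv (\<lambda>i. exit_kernel i x u w) (\<lambda>j. mass j w) m \<partial>count_space E)" for m
  proof -
    have "conv ?S (\<lambda>j. mass j 0) (Suc m) =
        (\<integral>\<^sup>+w. conv (\<lambda>i. exit_kernel i x u w) (conv (\<lambda>j. renewal j w) (\<lambda>j. mass j 0)) m \<partial>count_space E)"
      by (simp add: conv_Suc conv_nn_integral conv_assoc)
    also have "\<dots> = (\<integral>\<^sup>+w. conv (\<lambda>i. exit_kernel i x u w) (\<lambda>j. mass j w) m \<partial>count_space E)"
      by (intro nn_integral_cong conv_cong) (auto simp: mass_eq_conv_renewal)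
    finally show ?thesis .
  qed
  fix n
  have ux: "u + x \<in> E" using add_mem assms by simp
  show "conv (\<lambda>n. renewal n x + ?S n) (\<lambda>j. mass j 0) n = conv (\<lambda>n. renewal n (u + x)) (\<lambda>j. mass j 0) n"
    unfolding conv_add_left mass_eq_conv_renewal[OF ux, symmetric] mass_eq_conv_renewal[OF assms(1), symmetric]
  proof (cases n)
    case 0
    with assms ux zero_mem show "mass n x + conv ?S (\<lambda>j. mass j 0) n = mass n (u + x)" by simp
  next
    case (Suc m)
    then show "mass n x + conv ?S (\<lambda>j. mass j 0) n = mass n (u + x)"
      using S[of m] mass_Suc_add[OF assms, of m] by simp
  qed
  show "conv (\<lambda>n. renewal n (u + x)) (\<lambda>j. mass j 0) n < \<infinity>"
    by (rule conv_renewal_finite[OF ux])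
qed (simp add: zero_mem)

definition V :: "'a \<Rightarrow> ennreal" where
  "V x = (\<Sum>n. renewal n x)"

lemma V_add:
  assumes "x \<in> E" "u \<in> E"
  shows "V (u + x) = V x + (\<integral>\<^sup>+w. (\<Sum>i. exit_kernel i x u w) * V w \<partial>count_space E)"
proof -
  let ?S = "\<lambda>n. case n of 0 \<Rightarrow> 0
    | Suc m \<Rightarrow> \<integral>\<^sup>+w. conv (\<lambda>i. exit_kernel i x u w) (\<lambda>j. renewal j w) m \<partial>count_space E"
  have "V (u + x) = V x + (\<Sum>n. ?S n)"
    unfolding V_def renewal_add[OF assms] by (rule suminf_add[symmetric]) auto
  also have "(\<Sum>n. ?S n) = (\<Sum>m. ?S (Suc m))"
    by (subst suminf_offset[where i = 1]) auto
  also have "\<dots> = (\<integral>\<^sup>+w. (\<Sum>m. conv (\<lambda>i. exit_kernel i x u w) (\<lambda>j. renewal j w) m) \<partial>count_space E)"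
    by (simp add: nn_integral_suminf)
  finally show ?thesis
    by (simp add: suminf_conv V_def)
qed

text \<open>Since \<open>0 + E = E\<close>, the walk from \<open>0\<close> cannot leave
  \<open>0 + E\<close> without being killed.\<close>

lemma renewal_Suc_0 [simp]: "renewal (Suc n) 0 = 0"
  by (simp add: renewal_Suc exit_kernel_def conv_def image_iff)

lemma V_0 [simp]: "V 0 = 1"
proof -
  have "renewal n 0 = 0" if "n \<notin> {0}" for n
    using that by (cases n) auto
  then show ?thesis
    unfolding V_def by (subst suminf_finite[where N = "{0}"]) auto
qed

text \<open>This is the ladder height kernel, written as a sum over exit times instead of through
  the Green function; the final proof identifies it with \<open>ladder_p\<close>.\<close>

definition ladder_kernel :: "'a \<Rightarrow> 'a \<Rightarrow> ennreal" where
  "ladder_kernel x w = (\<Sum>i. exit_kernel i 0 x w)"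

lemma V_eq: "x \<in> E \<Longrightarrow> V x = 1 + (\<integral>\<^sup>+w. ladder_kernel x w * V w \<partial>count_space E)"
  using V_add[of 0 x] by (simp add: zero_mem ladder_kernel_def)

text \<open>The left side is the expected lifetime of the ladder height process. Both sides solve
  \<open>f = 1 + ladder_kernel f\<close>, and partial sums of either one stay below the other by
  induction.\<close>

lemma suminf_ladder_mass: 
  assumes "x \<in> E"
  shows "(\<Sum>n. kernel_mass E ladder_kernel n x) = V x"
proof (rule antisym)
  let ?m = "kernel_mass E ladder_kernel"
  have sum_Suc: "(\<Sum>n<Suc N. ?m n x) = 1 + (\<integral>\<^sup>+w. ladder_kernel x w * (\<Sum>n<N. ?m n w) \<partial>count_space E)"
    if "x \<in> E" for N x
    using that
    by (simp add: sum.lessThan_Suc_shift kernel_mass_Suc nn_integral_sum sum_distrib_left del: sum.lessThan_Suc)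
  have "(\<Sum>n<N. ?m n x) \<le> V x" if "x \<in> E" for N
    using that
  proof (induction N arbitrary: x)
    case (Suc N)
    then show ?case
      unfolding sum_Suc[OF Suc.prems] V_eq[OF Suc.prems]
      by (intro add_left_mono nn_integral_mono mult_left_mono) auto
  qed simp
  then show "(\<Sum>n. ?m n x) \<le> V x"
    using assms by (intro suminf_le_const) auto
  have eq: "(\<Sum>n. ?m n x) = 1 + (\<integral>\<^sup>+w. ladder_kernel x w * (\<Sum>n. ?m n w) \<partial>count_space E)"
    if "x \<in> E" for x
    by (subst suminf_offset[where i = 1])
       (use that in \<open>simp_all add: kernel_mass_Suc nn_integral_suminf[symmetric]\<close>)
  \<comment> \<open>Here a partial sum of convolutions is bounded by the full sum over exit times
    multiplied by a shorter sum of \<open>renewal\<close>.\<close>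
  have "(\<Sum>n<N. renewal n x) \<le> (\<Sum>n. ?m n x)" if "x \<in> E" for N
    using that
  proof (induction N arbitrary: x)
    case (Suc N)
    have "(\<Sum>n<Suc N. renewal n x) =
        1 + (\<integral>\<^sup>+w. (\<Sum>n<N. conv (\<lambda>i. exit_kernel i 0 x w) (\<lambda>j. renewal j w) n) \<partial>count_space E)"
      by (simp add: sum.lessThan_Suc_shift renewal_Suc nn_integral_sum del: sum.lessThan_Suc)
    also have "\<dots> \<le> 1 + (\<integral>\<^sup>+w. ladder_kernel x w * (\<Sum>n<N. renewal n w) \<partial>count_space E)"
      unfolding ladder_kernel_def by (intro add_left_mono nn_integral_mono sum_conv_le)
    also have "\<dots> \<le> 1 + (\<integral>\<^sup>+w. ladder_kernel x w * (\<Sum>n. ?m n w) \<partial>count_space E)"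
      using Suc.IH by (intro add_left_mono nn_integral_mono mult_left_mono) auto
    finally show ?case
      using eq[OF Suc.prems] by simp
  qed simp
  then show "V x \<le> (\<Sum>n. ?m n x)"
    unfolding V_def using assms by (intro suminf_le_const) auto
qed

lemma suminf_mass: "x \<in> E \<Longrightarrow> (\<Sum>n. mass n x) = V x * (\<Sum>n. mass n 0)"
  by (simp add: mass_eq_conv_renewal[of x] suminf_conv V_def)

subsection \<open>Superharmonicity\<close>

text \<open>The numbers \<open>r_j\<close> of the overview: after one step from \<open>0\<close>,
  time \<open>n\<close> is a ladder time of the walk restarted there.\<close>

definition return_seq :: "nat \<Rightarrow> ennreal" where
  "return_seq n = (\<integral>\<^sup>+z. p 0 z * renewal n z \<partial>count_space E)"

lemma conv_step_renewal:
  "conv (\<lambda>j. \<integral>\<^sup>+z. p x z * renewal j z \<partial>count_space E) (\<lambda>j. mass j 0) n = mass (Suc n) x"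
  unfolding conv_nn_integral kernel_mass_Suc
  by (intro nn_integral_cong) (simp add: mass_eq_conv_renewal conv_cmult_right)

lemma conv_return_seq: "conv return_seq (\<lambda>j. mass j 0) n = mass (Suc n) 0"
  using conv_step_renewal[of 0 n] unfolding return_seq_def[abs_def] .

text \<open>Convolution with the survival sequence of \<open>0\<close> turns both sides into
  \<open>mass (Suc n) x\<close>; on the right, the term \<open>renewal 0 x = 1\<close> supplies the
  summand \<open>mass (Suc n) 0\<close>.\<close>

lemma step_renewal:
  assumes "x \<in> E"
  shows "(\<integral>\<^sup>+z. p x z * renewal n z \<partial>count_space E) = renewal (Suc n) x + return_seq n"
proof (rule conv_right_cancel[where a = "\<lambda>j. mass j 0"])
  fix n
  have "mass (Suc n) x = mass (Suc n) 0 + conv (\<lambda>i. renewal (Suc i) x) (\<lambda>j. mass j 0) n"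
    using mass_eq_conv_renewal[OF assms, of "Suc n"] by (simp add: conv_Suc)
  then have eq: "conv (\<lambda>n. renewal (Suc n) x + return_seq n) (\<lambda>j. mass j 0) n = mass (Suc n) x"
    by (simp add: conv_add_left conv_return_seq add.commute)
  then show "conv (\<lambda>n. \<integral>\<^sup>+z. p x z * renewal n z \<partial>count_space E) (\<lambda>j. mass j 0) n =
      conv (\<lambda>n. renewal (Suc n) x + return_seq n) (\<lambda>j. mass j 0) n"
    by (simp add: conv_step_renewal)
  show "conv (\<lambda>n. renewal (Suc n) x + return_seq n) (\<lambda>j. mass j 0) n < \<infinity>"
    unfolding eq using mass_le_1[OF assms, of "Suc n"] by (simp add: le_less_trans)
qed (simp add: zero_mem)

text \<open>The 1 is the term \<open>renewal 0 x\<close>; it is added on the left to avoid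
  subtraction in \<open>ennreal\<close>.\<close>

lemma step_V:
  assumes "x \<in> E"
  shows "(\<integral>\<^sup>+z. p x z * V z \<partial>count_space E) + 1 = V x + (\<Sum>n. return_seq n)"
proof -
  have "(\<integral>\<^sup>+z. p x z * V z \<partial>count_space E) = (\<Sum>n. renewal (Suc n) x) + (\<Sum>n. return_seq n)"
    unfolding V_def
    by (simp add: ennreal_suminf_cmult[symmetric] nn_integral_suminf step_renewal[OF assms] suminf_add
        del: ennreal_suminf_cmult)
  moreover have "V x = (\<Sum>n. renewal (Suc n) x) + 1"
    unfolding V_def by (subst suminf_offset[where i = 1]) auto
  ultimately show ?thesis
    by (simp add: ac_simps)
qed

lemma return_seq_mult_mass_le: "(\<Sum>i\<le>n. return_seq i) * mass n 0 \<le> mass (Suc n) 0"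
  using partial_sum_mult_le_conv[OF decseq_mass[OF zero_mem], of return_seq n]
  by (simp only: conv_return_seq)

text \<open>If the sum were \<open>\<rho> < 1\<close>, the partial sums \<open>S\<close> of the
  survival sequence would satisfy \<open>S \<le> 1 + \<rho> S\<close> and hence be bounded by
  \<open>1 / (1 - \<rho>)\<close>.\<close>

lemma suminf_return_seq_eq_1:
  assumes "(\<Sum>n. mass n 0) = \<infinity>" and "(\<Sum>n. return_seq n) \<le> 1"
  shows "(\<Sum>n. return_seq n) = 1"
proof (rule ccontr)
  assume "(\<Sum>n. return_seq n) \<noteq> 1"
  then obtain \<rho> where \<rho>: "(\<Sum>n. return_seq n) = ennreal \<rho>" "0 \<le> \<rho>" "\<rho> < 1"
    using assms(2) by (cases "\<Sum>n. return_seq n") (auto simp: top_unique)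
  have "(\<Sum>n<N. mass n 0) \<le> ennreal (1 / (1 - \<rho>))" for N
  proof -
    have "(\<Sum>n<N. mass n 0) \<le> (\<Sum>n<Suc N. mass n 0)"
      by (rule sum_mono2) auto
    also have "\<dots> = 1 + (\<Sum>n<N. conv return_seq (\<lambda>j. mass j 0) n)"
      using zero_mem by (simp add: sum.lessThan_Suc_shift conv_return_seq del: sum.lessThan_Suc)
    also have "\<dots> \<le> 1 + ennreal \<rho> * (\<Sum>n<N. mass n 0)"
      unfolding \<rho>(1)[symmetric] by (intro add_left_mono sum_conv_le)
    finally have le: "(\<Sum>n<N. mass n 0) \<le> 1 + ennreal \<rho> * (\<Sum>n<N. mass n 0)" .
    \<comment> \<open>Each term is at most 1, so the partial sum is a real number and the inequality
      can be rearranged.\<close>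
    have "(\<Sum>n<N. mass n 0) \<le> (\<Sum>n<N. 1)"
      by (intro sum_mono mass_le_1 zero_mem)
    then have "(\<Sum>n<N. mass n 0) < \<infinity>"
      by (rule le_less_trans) (simp add: of_nat_less_top)
    then obtain s where s: "(\<Sum>n<N. mass n 0) = ennreal s" "0 \<le> s"
      by (cases "\<Sum>n<N. mass n 0") auto
    with le \<rho> have "s \<le> 1 + \<rho> * s"
      by (simp flip: ennreal_mult ennreal_plus ennreal_1)
    then show ?thesis
      using s \<rho> by (simp add: field_simps ennreal_leI)
  qed
  then have "(\<Sum>n. mass n 0) \<le> ennreal (1 / (1 - \<rho>))"
    by (intro suminf_le_const) auto
  then show False
    using assms(1) by (simp add: top_unique)
qed

end

locale irreducible_semigroup_walk = semigroup_walk +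
  assumes irreducible: "\<And>x y. x \<in> E \<Longrightarrow> y \<in> E \<Longrightarrow> \<exists>n\<ge>1. pow n x y > 0"
begin

text \<open>A loop at \<open>0\<close> of positive probability and length \<open>m \<ge> 1\<close>
  can be repeated arbitrarily often, and survival probabilities decrease in time. Positivity makes
  the ratios below meaningful.\<close>

lemma mass_0_pos: "mass n 0 > 0"
proof -
  obtain m where m: "m \<ge> 1" "pow m 0 0 > 0"
    using irreducible zero_mem by blast
  have "mass (k * m) 0 > 0" for k
  proof (induction k)
    case (Suc k)
    have "pow m 0 0 * mass (k * m) 0 \<le> mass (m + k * m) 0"
      unfolding kernel_mass_add[OF zero_mem] by (rule nn_integral_ge_point) (rule zero_mem)
    moreover have "0 < pow m 0 0 * mass (k * m) 0"
      using m Suc by (simp add: ennreal_zero_less_mult_iff)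
    ultimately show ?case by simp
  qed (simp add: zero_mem)
  moreover have "mass (n * m) 0 \<le> mass n 0"
    using m by (intro decseqD[OF decseq_mass] zero_mem) simp
  ultimately show ?thesis
    by (metis less_le_trans)
qed

lemma mass_0_neq [simp]: "mass n 0 \<noteq> 0" "mass n 0 \<noteq> top"
  using mass_0_pos[of n] mass_le_1[OF zero_mem, of n] by (auto simp: top_unique)

lemma return_seq_le_ratio: "(\<Sum>i\<le>n. return_seq i) \<le> mass (Suc n) 0 / mass n 0"
  using divide_right_mono_ennreal[OF return_seq_mult_mass_le[of n], of "mass n 0"]
  by (simp add: ennreal_mult_divide_eq)

lemma mass_ratio_le_1: "mass (Suc n) 0 / mass n 0 \<le> 1"
  using mass_Suc_le[OF zero_mem, of n] by (intro divide_le_posI_ennreal mass_0_pos) simp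

lemma suminf_return_seq_le_1: "(\<Sum>n. return_seq n) \<le> 1"
proof (rule suminf_le_const)
  fix n
  have "(\<Sum>i<n. return_seq i) \<le> (\<Sum>i\<le>n. return_seq i)"
    by (rule sum_mono2) auto
  also have "\<dots> \<le> 1"
    using return_seq_le_ratio mass_ratio_le_1 by (rule order_trans)
  finally show "(\<Sum>i<n. return_seq i) \<le> 1" .
qed simp

lemma V_superharmonic:
  assumes "x \<in> E"
  shows "(\<integral>\<^sup>+z. p x z * V z \<partial>count_space E) \<le> V x"
proof -
  have "1 + (\<integral>\<^sup>+z. p x z * V z \<partial>count_space E) \<le> 1 + V x"
    using step_V[OF assms] suminf_return_seq_le_1 by (simp add: add.commute add_left_mono)
  then show ?thesis
    by (simp add: ennreal_add_left_cancel_le)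
qed

lemma nn_integral_pow_Suc:
  "(\<integral>\<^sup>+z. pow (Suc n) x z * f z \<partial>count_space E) =
    (\<integral>\<^sup>+w. p x w * (\<integral>\<^sup>+z. pow n w z * f z \<partial>count_space E) \<partial>count_space E)"
proof -
  have "(\<integral>\<^sup>+z. pow (Suc n) x z * f z \<partial>count_space E) =
      (\<integral>\<^sup>+z. \<integral>\<^sup>+w. p x w * (pow n w z * f z) \<partial>count_space E \<partial>count_space E)"
    by (simp add: nn_integral_multc mult.assoc[symmetric])
  also have "\<dots> = (\<integral>\<^sup>+w. \<integral>\<^sup>+z. p x w * (pow n w z * f z) \<partial>count_space E \<partial>count_space E)"
    by (rule nn_integral_count_space_swap)
  finally show ?thesis
    by (simp add: nn_integral_cmult)
qed

lemma pow_V_le: "x \<in> E \<Longrightarrow> (\<integral>\<^sup>+z. pow n x z * V z \<partial>count_space E) \<le> V x"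
proof (induction n arbitrary: x)
  case (Suc n)
  have "(\<integral>\<^sup>+z. pow (Suc n) x z * V z \<partial>count_space E) \<le> (\<integral>\<^sup>+w. p x w * V w \<partial>count_space E)"
    unfolding nn_integral_pow_Suc using Suc.IH by (intro nn_integral_mono mult_left_mono) auto
  also have "\<dots> \<le> V x"
    using Suc.prems by (rule V_superharmonic)
  finally show ?case .
qed (simp add: nn_integral_point_left)

text \<open>Iterated superharmonicity gives \<open>pow n 0 x * V x \<le> V 0 = 1\<close>, and
  irreducibility makes the coefficient positive for some \<open>n\<close>.\<close>

lemma V_finite:
  assumes "x \<in> E"
  shows "V x < \<infinity>"
proof (rule ccontr)
  obtain n where n: "pow n 0 x > 0"
    using irreducible[OF zero_mem assms] by blast
  assume "\<not> V x < \<infinity>"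
  then have "V x = top"
    by (simp add: less_top[symmetric])
  have "pow n 0 x * V x \<le> V 0"
    using nn_integral_ge_point[OF assms, of "\<lambda>z. pow n 0 z * V z"] pow_V_le[OF zero_mem, of n]
    by (rule order_trans)
  then show False
    using n \<open>V x = top\<close> by (auto simp: ennreal_mult_top top_unique split: if_splits)
qed

lemma sum_renewal_le_ratio:
  assumes "x \<in> E"
  shows "(\<Sum>i\<le>n. renewal i x) \<le> mass n x / mass n 0"
proof -
  have "(\<Sum>i\<le>n. renewal i x) * mass n 0 \<le> mass n x"
    unfolding mass_eq_conv_renewal[OF assms]
    by (rule partial_sum_mult_le_conv) (rule decseq_mass[OF zero_mem])
  from divide_right_mono_ennreal[OF this, of "mass n 0"] show ?thesis
    by (simp add: ennreal_mult_divide_eq)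
qed

lemma sum_renewal_tendsto: "(\<lambda>n. \<Sum>i\<le>n. renewal i x) \<longlonglongrightarrow> V x"
  unfolding V_def by (rule summable_LIMSEQ') simp

lemma V_le_liminf: "x \<in> E \<Longrightarrow> V x \<le> liminf (\<lambda>n. mass n x / mass n 0)"
  using lim_imp_Liminf[OF _ sum_renewal_tendsto[of x]]
    Liminf_mono[of "\<lambda>n. \<Sum>i\<le>n. renewal i x" "\<lambda>n. mass n x / mass n 0" sequentially]
  by (simp add: sum_renewal_le_ratio)

subsection \<open>The case of infinite expected lifetime\<close>

context
  assumes infinite_lifetime: "(\<Sum>n. mass n 0) = \<infinity>"
begin

lemma V_harmonic:
  assumes "x \<in> E"
  shows "(\<integral>\<^sup>+z. p x z * V z \<partial>count_space E) = V x"
proof -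
  have "1 + (\<integral>\<^sup>+z. p x z * V z \<partial>count_space E) = 1 + V x"
    using step_V[OF assms] suminf_return_seq_eq_1[OF infinite_lifetime suminf_return_seq_le_1]
    by (simp add: add.commute)
  then show ?thesis
    by (simp add: ennreal_add_left_cancel)
qed

lemma pow_V: "x \<in> E \<Longrightarrow> (\<integral>\<^sup>+z. pow n x z * V z \<partial>count_space E) = V x"
proof (induction n arbitrary: x)
  case (Suc n)
  then show ?case
    unfolding nn_integral_pow_Suc using V_harmonic[OF Suc.prems] by (simp cong: nn_integral_cong_simp)
qed (simp add: nn_integral_point_left)

text \<open>The ratio lies between the partial sums of \<open>return_seq\<close>, whose limit is 1,
  and 1 itself.\<close>

lemma mass_Suc_ratio_tendsto: "(\<lambda>n. mass (Suc n) 0 / mass n 0) \<longlonglongrightarrow> 1"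
proof (rule tendsto_sandwich)
  show "(\<lambda>n. \<Sum>i\<le>n. return_seq i) \<longlonglongrightarrow> 1"
    unfolding suminf_return_seq_eq_1[OF infinite_lifetime suminf_return_seq_le_1, symmetric]
    by (rule summable_LIMSEQ') simp
qed (auto simp: return_seq_le_ratio mass_ratio_le_1)

text \<open>A telescoping product of \<open>m\<close> one-step ratios.\<close>

lemma mass_add_ratio_tendsto: "(\<lambda>n. mass (m + n) 0 / mass n 0) \<longlonglongrightarrow> 1"
proof (induction m)
  case (Suc m)
  have "(\<lambda>n. mass (Suc (n + m)) 0 / mass (n + m) 0 * (mass (m + n) 0 / mass n 0)) \<longlonglongrightarrow> 1 * 1"
    using LIMSEQ_ignore_initial_segment[OF mass_Suc_ratio_tendsto, of m] Suc
    by (intro tendsto_mult_ennreal) auto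
  moreover have "mass (Suc (n + m)) 0 / mass (n + m) 0 * (mass (m + n) 0 / mass n 0) =
      mass (Suc m + n) 0 / mass n 0" for n
    by (simp add: ennreal_times_divide ennreal_divide_times add.commute mult.commute)
      (metis ennreal_mult_divide_eq ennreal_times_divide mass_0_neq mult.commute)
  ultimately show ?case by simp
qed (simp add: less_top[symmetric])

text \<open>Only the upper bound is new. Splitting survival from \<open>0\<close> at a time
  \<open>m\<close> when \<open>x\<close> is reached with positive probability expresses a quantity
  tending to 1 as a sum over positions. The other positions have their lower bounds, which leaves at
  most the share of \<open>x\<close> in \<open>pow_V\<close>.\<close>

lemma mass_ratio_tendsto_V:
  assumes "x \<in> E"
  shows "(\<lambda>n. mass n x / mass n 0) \<longlonglongrightarrow> V x"
proof -
  obtain m where w: "pow m 0 x > 0"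
    using irreducible[OF zero_mem assms] by blast
  let ?w = "pow m 0 x" and ?C = "\<lambda>n z. \<Sum>i\<le>n. renewal i z"
  \<comment> \<open>\<open>I n\<close> bounds from below what the positions other than
    \<open>x\<close> contribute, and \<open>J\<close> is its limit by monotone convergence.\<close>
  define I where "I n = (\<integral>\<^sup>+z. (if z = x then 0 else pow m 0 z * ?C n z) \<partial>count_space E)" for n
  define J where "J = (\<integral>\<^sup>+z. (if z = x then 0 else pow m 0 z * V z) \<partial>count_space E)"
  have "?w \<le> mass m 0"
    unfolding kernel_mass_def using assms by (rule nn_integral_ge_point)
  then have w_top: "?w \<noteq> top"
    using mass_le_1[OF zero_mem, of m] by (auto simp: top_unique)
  have inv: "inverse ?w * ?w = 1"
    using ennreal_divide_self[of ?w] w w_top by (simp add: divide_ennreal_def mult.commute less_top)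
  have V: "?w * V x + J = 1"
    using pow_V[OF zero_mem, of m] nn_integral_remove_point[OF assms, of "\<lambda>z. pow m 0 z * V z"]
    unfolding J_def by simp
  \<comment> \<open>Finiteness of \<open>J\<close> lets the subtraction in \<open>ennreal\<close>
    pass to the limit.\<close>
  then have "J \<le> 1"
    by (metis add_increasing le_iff_add order_refl zero_le)
  then have J_top: "J \<noteq> top"
    by (auto simp: top_unique)
  have I: "I \<longlonglongrightarrow> J"
    unfolding I_def[abs_def] J_def
  proof (rule nn_integral_LIMSEQ)
    show "incseq (\<lambda>n z. if z = x then 0 else pow m 0 z * ?C n z)"
      by (auto intro!: incseq_SucI le_funI mult_left_mono)
    fix z
    have "(\<lambda>n. \<Sum>i\<le>n. pow m 0 z * renewal i z) \<longlonglongrightarrow> (\<Sum>i. pow m 0 z * renewal i z)"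
      by (rule summable_LIMSEQ') simp
    then show "(\<lambda>n. if z = x then 0 else pow m 0 z * ?C n z) \<longlonglongrightarrow> (if z = x then 0 else pow m 0 z * V z)"
      by (simp add: sum_distrib_left V_def)
  qed simp
  have le: "mass n x / mass n 0 \<le> inverse ?w * (mass (m + n) 0 / mass n 0 - I n)" for n
  proof -
    have "mass (m + n) 0 / mass n 0 = (\<integral>\<^sup>+z. pow m 0 z * (mass n z / mass n 0) \<partial>count_space E)"
      unfolding kernel_mass_add[OF zero_mem] by (simp add: nn_integral_divide ennreal_times_divide)
    also have "\<dots> = ?w * (mass n x / mass n 0) +
        (\<integral>\<^sup>+z. (if z = x then 0 else pow m 0 z * (mass n z / mass n 0)) \<partial>count_space E)"
      using assms by (rule nn_integral_remove_point)
    also have "\<dots> \<ge> ?w * (mass n x / mass n 0) + I n"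
      unfolding I_def
      by (intro add_left_mono nn_integral_mono) (auto intro!: mult_left_mono sum_renewal_le_ratio)
    finally have "?w * (mass n x / mass n 0) \<le> mass (m + n) 0 / mass n 0 - I n"
      by (simp add: ennreal_le_minus_iff)
    then have "inverse ?w * (?w * (mass n x / mass n 0)) \<le> inverse ?w * (mass (m + n) 0 / mass n 0 - I n)"
      by (rule mult_left_mono) simp
    then show ?thesis
      by (simp add: mult.assoc[symmetric] inv)
  qed
  have "(\<lambda>n. mass (m + n) 0 / mass n 0 - I n) \<longlonglongrightarrow> 1 - J"
    using mass_add_ratio_tendsto I J_top by (intro tendsto_diff_ennreal) auto
  then have "(\<lambda>n. inverse ?w * (mass (m + n) 0 / mass n 0 - I n)) \<longlonglongrightarrow> inverse ?w * (1 - J)"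
    using inv by (intro ennreal_tendsto_cmult) (auto simp: less_top[symmetric] ennreal_top_mult)
  also have "1 - J = ?w * V x"
    unfolding V[symmetric] using J_top by simp
  also have "inverse ?w * (?w * V x) = V x"
    by (simp add: mult.assoc[symmetric] inv)
  finally show ?thesis
    by (rule tendsto_sandwich[OF always_eventually[OF allI[OF sum_renewal_le_ratio[OF assms]]]
        always_eventually[OF allI[OF le]] sum_renewal_tendsto])
qed

end

end

subsection \<open>The exit from a shifted semigroup\<close>

context semigroup_walk
begin

lemma kernel_pow_shift:
  "kernel_pow ((+) u ` E) p n (u + x) (u + z) = pow n x z"
proof (induction n arbitrary: x)
  case (Suc n)
  have "kernel_pow ((+) u ` E) p (Suc n) (u + x) (u + z) =
      (\<integral>\<^sup>+v. p (u + x) (u + v) * kernel_pow ((+) u ` E) p n (u + v) (u + z) \<partial>count_space E)"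
    unfolding kernel_pow.simps
    by (rule nn_integral_bij_count_space[symmetric]) (auto intro: bij_betw_imageI)
  then show ?case
    by (simp add: Suc invariant)
qed simp

abbreviation law :: "'a \<Rightarrow> (nat \<Rightarrow> 'a option) measure" where
  "law x \<equiv> chain_law (cemetery_kernel E p) (Some x)"

text \<open>Confirms the probabilistic meaning of \<open>exit_kernel\<close>: before the exit the
  walk is confined to \<open>u + E\<close>, where its powers are translates of those on
  \<open>E\<close>, and one more step follows.\<close>

lemma emeasure_exit:
  assumes "x \<in> E" "u \<in> E" "w \<in> E - (+) u ` E"
  shows "emeasure (law (u + x)) {\<omega>. (\<forall>i\<le>n. \<omega> i \<in> Some ` (+) u ` E) \<and> \<omega> (Suc n) = Some w} =
    exit_kernel n x u w"
proof -
  let ?U = "(+) u ` E"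
  let ?F = "\<lambda>z. {\<omega>. (\<forall>i\<le>n. \<omega> i \<in> Some ` ?U) \<and> \<omega> n = Some (u + z) \<and> \<omega> (Suc n) = Some w}"
  have U: "?U \<subseteq> E" using assms add_mem by auto
  have exit: "{\<omega>. (\<forall>i\<le>n. \<omega> i \<in> Some ` ?U) \<and> \<omega> (Suc n) = Some w} = (\<Union>z\<in>E. ?F z)"
  proof (intro set_eqI iffI)
    fix \<omega> assume \<omega>: "\<omega> \<in> {\<omega>. (\<forall>i\<le>n. \<omega> i \<in> Some ` ?U) \<and> \<omega> (Suc n) = Some w}"
    then have "\<omega> n \<in> Some ` ?U" by simp
    then obtain z where "z \<in> E" "\<omega> n = Some (u + z)" by auto
    with \<omega> show "\<omega> \<in> (\<Union>z\<in>E. ?F z)" by auto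
  qed auto
  have "emeasure (law (u + x)) (\<Union>z\<in>E. ?F z) = (\<integral>\<^sup>+z. emeasure (law (u + x)) (?F z) \<partial>count_space E)"
  proof (rule emeasure_UN_countable)
    show "?F z \<in> sets (law (u + x))" for z by (rule chain_law_stay_sets)
  qed (auto simp: disjoint_family_on_def)
  also have "\<dots> = (\<integral>\<^sup>+z. pow n x z * p (u + z) w \<partial>count_space E)"
  proof (rule nn_integral_cong)
    fix z assume "z \<in> space (count_space E)"
    then have "u + x \<in> ?U" "u + z \<in> ?U"
      using assms(1) by simp_all
    from emeasure_killed_stay[where p = p, OF substochastic U this]
    have "emeasure (law (u + x)) {\<omega>. (\<forall>i\<le>n. \<omega> i \<in> Some ` ?U) \<and> \<omega> n = Some (u + z)} = pow n x z"
      unfolding kernel_pow_shift .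
    moreover have "ennreal (pmf (cemetery_kernel E p (Some (u + z))) (Some w)) = p (u + z) w"
      by (rule pmf_cemetery_kernel(1)[where p = p, OF substochastic]) (rule DiffD1[OF assms(3)])
    ultimately show "emeasure (law (u + x)) (?F z) = pow n x z * p (u + z) w"
      unfolding chain_law_step_stay by (simp only:)
  qed
  finally show ?thesis
    unfolding exit exit_kernel_def if_P[OF assms(3)] .
qed

text \<open>Decomposition by exit time and exit position. The condition \<open>T < lifetime\<close>
  excludes exits to the cemetery, where both times agree, and infinite \<open>T\<close>, where
  \<open>the_enat\<close> has no meaning.\<close>

lemma nn_integral_at_exit:
  fixes g :: "'a option \<Rightarrow> ennreal" and u :: 'a
  defines "T \<equiv> \<lambda>\<omega>. first_time (\<lambda>t. \<omega> t \<notin> Some ` (+) u ` E)"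
  assumes "x \<in> E" "u \<in> E"
  shows "(\<integral>\<^sup>+\<omega>\<in>{\<omega>. T \<omega> < lifetime \<omega>}. g (\<omega> (the_enat (T \<omega>))) \<partial>law (u + x)) =
    (\<integral>\<^sup>+w. (\<Sum>n. exit_kernel n x u w) * g (Some w) \<partial>count_space E)"
proof -
  let ?U = "(+) u ` E"
  let ?stay = "\<lambda>n \<omega>. \<forall>i\<le>n. \<omega> i \<in> Some ` ?U"
  let ?D = "\<lambda>n w. {\<omega>. ?stay n \<omega> \<and> \<omega> (Suc n) = Some w}"
  let ?h = "\<lambda>n w \<omega>. if w \<in> E - ?U then g (Some w) * indicator (?D n w) \<omega> else 0"
  have ux: "u + x \<in> E" using assms add_mem by simp
  have D: "?D n w \<in> sets (law (u + x))" for n w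
    using chain_law_stay_sets[of n "Some ` ?U" "\<lambda>_. True" 0 "\<lambda>s. s = Some w" "Suc n"] by simp
  have meas: "?h n w \<in> borel_measurable (law (u + x))" for n w
  proof (cases "w \<in> E - ?U")
    case True
    have "(\<lambda>\<omega>. g (Some w) * indicator (?D n w) \<omega>) \<in> borel_measurable (law (u + x))"
      by (intro borel_measurable_times_ennreal borel_measurable_const borel_measurable_indicator D)
    then show ?thesis unfolding if_P[OF True] .
  next
    case False
    show ?thesis unfolding if_not_P[OF False] by simp
  qed
  have h: "(\<integral>\<^sup>+w. ?h n w \<omega> \<partial>count_space E) =
      (if ?stay n \<omega> \<and> \<omega> (Suc n) \<in> Some ` (E - ?U) then g (\<omega> (Suc n)) else 0)" for n \<omega>
  proof (cases "?stay n \<omega> \<and> \<omega> (Suc n) \<in> Some ` (E - ?U)")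
    case True
    then obtain y where y: "y \<in> E - ?U" "\<omega> (Suc n) = Some y" "?stay n \<omega>"
      by blast
    have "(\<integral>\<^sup>+w. ?h n w \<omega> \<partial>count_space E) = (\<integral>\<^sup>+w. g (Some w) * (if w = y then 1 else 0) \<partial>count_space E)"
      using y by (intro nn_integral_cong) (auto simp: indicator_def)
    then show ?thesis
      unfolding if_P[OF True] using y by (simp add: nn_integral_point_right)
  next
    case False
    then have "?h n w \<omega> = 0" for w
      by (auto simp: indicator_def)
    then show ?thesis
      unfolding if_not_P[OF False] by simp
  qed
  \<comment> \<open>At most one summand is non-zero, the one with \<open>T = n + 1\<close>; the
    index is shifted because exit times are positive.\<close>
  have "AE \<omega> in law (u + x). g (\<omega> (the_enat (T \<omega>))) * indicator {\<omega>. T \<omega> < lifetime \<omega>} \<omega> =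
      (\<Sum>n. \<integral>\<^sup>+w. ?h n w \<omega> \<partial>count_space E)"
    using AE_killed[OF substochastic ux] AE_killed_alive[OF substochastic ux]
  proof eventually_elim
    case (elim \<omega>)
    have start: "\<omega> 0 \<in> Some ` ?U" using elim(1)[THEN conjunct1] assms(2) by simp
    have alive: "enat n < lifetime \<omega> \<longleftrightarrow> \<omega> n \<in> Some ` E" for n
      using elim(2)[THEN spec, THEN conjunct2] .
    have stay: "?stay n \<omega> \<longleftrightarrow> (\<forall>i\<in>{1..n}. \<omega> i \<in> Some ` ?U)" for n
      using start by (metis One_nat_def Suc_leI atLeastAtMost_iff gr0I)
    have exit: "?stay n \<omega> \<and> \<omega> (Suc n) \<in> Some ` (E - ?U) \<longleftrightarrow> T \<omega> = enat (Suc n) \<and> T \<omega> < lifetime \<omega>" for n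
    proof -
      have "Some ` (E - ?U) = Some ` E - Some ` ?U" by auto
      moreover have "T \<omega> = enat (Suc n) \<longleftrightarrow> \<omega> (Suc n) \<notin> Some ` ?U \<and> ?stay n \<omega>"
        unfolding T_def first_time_eq_Suc_iff stay by simp
      ultimately show ?thesis
        using alive[of "Suc n"] by (metis Diff_iff)
    qed
    show ?case
    proof (cases "T \<omega> < lifetime \<omega>")
      case True
      then obtain m where m: "T \<omega> = enat m"
        by (cases "T \<omega>") auto
      moreover have "T \<omega> \<noteq> 0" unfolding T_def by (rule first_time_positive)
      ultimately obtain n where n: "T \<omega> = enat (Suc n)"
        by (cases m) (auto simp: enat_0)
      have "(\<Sum>k. \<integral>\<^sup>+w. ?h k w \<omega> \<partial>count_space E) = (\<Sum>k\<in>{n}. \<integral>\<^sup>+w. ?h k w \<omega> \<partial>count_space E)"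
        unfolding h exit by (rule suminf_finite) (auto simp: n)
      also have "\<dots> = g (\<omega> (Suc n))"
        unfolding h exit using True n by simp
      finally show ?thesis
        using True n by simp
    next
      case False
      then show ?thesis
        unfolding h exit by simp
    qed
  qed
  then have "(\<integral>\<^sup>+\<omega>\<in>{\<omega>. T \<omega> < lifetime \<omega>}. g (\<omega> (the_enat (T \<omega>))) \<partial>law (u + x)) =
      (\<integral>\<^sup>+\<omega>. (\<Sum>n. \<integral>\<^sup>+w. ?h n w \<omega> \<partial>count_space E) \<partial>law (u + x))"
    by (rule nn_integral_cong_AE)
  also have "\<dots> = (\<Sum>n. \<integral>\<^sup>+w. \<integral>\<^sup>+\<omega>. ?h n w \<omega> \<partial>law (u + x) \<partial>count_space E)"
  proof -
    have "(\<integral>\<^sup>+\<omega>. (\<Sum>n. \<integral>\<^sup>+w. ?h n w \<omega> \<partial>count_space E) \<partial>law (u + x)) =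
        (\<Sum>n. \<integral>\<^sup>+\<omega>. \<integral>\<^sup>+w. ?h n w \<omega> \<partial>count_space E \<partial>law (u + x))"
    proof (rule nn_integral_suminf)
      fix n
      show "(\<lambda>\<omega>. \<integral>\<^sup>+w. ?h n w \<omega> \<partial>count_space E) \<in> borel_measurable (law (u + x))"
        unfolding h
      proof (rule measurable_If)
        have "(\<lambda>\<omega>. \<omega> (Suc n)) \<in> law (u + x) \<rightarrow>\<^sub>M count_space UNIV"
          by measurable
        then show "(\<lambda>\<omega>. g (\<omega> (Suc n))) \<in> borel_measurable (law (u + x))"
          by (rule measurable_compose) simp
        show "{\<omega> \<in> space (law (u + x)). ?stay n \<omega> \<and> \<omega> (Suc n) \<in> Some ` (E - ?U)} \<in> sets (law (u + x))"
          using chain_law_stay_sets[of n "Some ` ?U" "\<lambda>_. True" 0 "\<lambda>s. s \<in> Some ` (E - ?U)" "Suc n"] by simp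
      qed simp
    qed
    also have "\<dots> = (\<Sum>n. \<integral>\<^sup>+w. \<integral>\<^sup>+\<omega>. ?h n w \<omega> \<partial>law (u + x) \<partial>count_space E)"
      by (intro suminf_cong nn_integral_count_space_nn_integral) (auto intro: meas)
    finally show ?thesis .
  qed
  also have "\<dots> = (\<Sum>n. \<integral>\<^sup>+w. exit_kernel n x u w * g (Some w) \<partial>count_space E)"
  proof (intro suminf_cong nn_integral_cong)
    fix n w
    show "(\<integral>\<^sup>+\<omega>. ?h n w \<omega> \<partial>law (u + x)) = exit_kernel n x u w * g (Some w)"
    proof (cases "w \<in> E - ?U")
      case True
      have "(\<integral>\<^sup>+\<omega>. g (Some w) * indicator (?D n w) \<omega> \<partial>law (u + x)) = g (Some w) * exit_kernel n x u w"
        using emeasure_exit[OF assms(2,3) True, of n] D by (simp add: nn_integral_cmult_indicator del: sets_chain_law)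
      then show ?thesis
        unfolding if_P[OF True] by (simp only: mult.commute)
    next
      case False
      then show ?thesis
        unfolding if_not_P[OF False] exit_kernel_def by simp
    qed
  qed
  also have "\<dots> = (\<integral>\<^sup>+w. (\<Sum>n. exit_kernel n x u w) * g (Some w) \<partial>count_space E)"
    by (subst nn_integral_suminf[symmetric]) simp_all
  finally show ?thesis .
qed

end

subsection \<open>The ladder height process\<close>

text \<open>The expected number of visits to a single point is at most the expected
  lifetime.\<close>

lemma transient_on_killed:
  fixes q :: "'a::countable \<Rightarrow> 'a \<Rightarrow> ennreal"
  assumes "\<And>x. (\<integral>\<^sup>+y. q x y \<partial>count_space E) \<le> 1"
    and "\<And>x. x \<in> E \<Longrightarrow> (\<Sum>n. kernel_mass E q n x) < \<infinity>"
  shows "transient_on E (\<lambda>x. chain_law (cemetery_kernel E q) (Some x))"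
  unfolding transient_on_def
proof (intro ballI)
  fix x y assume "x \<in> E" "y \<in> E"
  have "green (\<lambda>x. chain_law (cemetery_kernel E q) (Some x)) x y = (\<Sum>n. kernel_pow E q n x y)"
    using assms(1) \<open>x \<in> E\<close> \<open>y \<in> E\<close> by (rule green_killed)
  also have "\<dots> \<le> (\<Sum>n. kernel_mass E q n x)"
    unfolding kernel_mass_def using \<open>y \<in> E\<close> by (intro suminf_le nn_integral_ge_point) auto
  finally show "green (\<lambda>x. chain_law (cemetery_kernel E q) (Some x)) x y < \<infinity>"
    using assms(2)[OF \<open>x \<in> E\<close>] by (rule le_less_trans)
qed

theorem corollary4p1:
  fixes \<mu> :: "(int ^ 'd::finite) pmf" and E :: "(int ^ 'd) set"
  assumes "0 \<in> E"
    and "\<forall>x\<in>E. \<forall>u\<in>E. x + u \<in> E"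
    and "irreducible_on E (walk_law \<mu> E)"
    and "transient_on E (walk_law \<mu> E)"
  shows
    "transient_on E (ladder_law \<mu> E)
     \<and>
     ((\<forall>x\<in>E. ladder_V \<mu> E (Some x) < \<infinity>) \<and> ladder_V \<mu> E (Some 0) = 1 \<and>
      (\<forall>x\<in>E. \<forall>u\<in>E.
         ladder_V \<mu> E (Some (x + u)) =
           ladder_V \<mu> E (Some x) +
           (\<integral>\<^sup>+\<omega>\<in>{\<omega>. exit_time E u \<omega> < lifetime \<omega>}.
              ladder_V \<mu> E (\<omega> (the_enat (exit_time E u \<omega>))) \<partial>walk_law \<mu> E (x + u))))
     \<and>
     ((\<forall>x\<in>E. expected_lifetime (walk_law \<mu> E) x = \<infinity>) \<longrightarrow>
        harmonic_on \<mu> E (\<lambda>x. ladder_V \<mu> E (Some x)) \<and>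
        (\<forall>x\<in>E. (\<lambda>n. survival (walk_law \<mu> E) x n / survival (walk_law \<mu> E) 0 n)
                  \<longlonglongrightarrow> ladder_V \<mu> E (Some x)))
     \<and>
     ((\<forall>x\<in>E. expected_lifetime (walk_law \<mu> E) x < \<infinity>) \<longrightarrow>
        potential_on \<mu> E (\<lambda>x. ladder_V \<mu> E (Some x)) \<and>
        (\<forall>x\<in>E.
           ladder_V \<mu> E (Some x) =
             expected_lifetime (walk_law \<mu> E) x / expected_lifetime (walk_law \<mu> E) 0 \<and>
           ladder_V \<mu> E (Some x) \<le>
             liminf (\<lambda>n. survival (walk_law \<mu> E) x n / survival (walk_law \<mu> E) 0 n)))"
proof -
  have walk_law: "walk_law \<mu> E = (\<lambda>x. chain_law (cemetery_kernel E (walk_p \<mu>)) (Some x))"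
    by (rule ext) (simp add: walk_law_def)
  interpret irreducible_semigroup_walk "walk_p \<mu>" E
  proof
    show "(\<integral>\<^sup>+y. walk_p \<mu> x y \<partial>count_space E) \<le> 1" for x
      by (rule walk_p_substochastic)
    show "walk_p \<mu> (u + x) (u + y) = walk_p \<mu> x y" for u x y
      by (simp add: walk_p_def)
    show "\<exists>n\<ge>1. kernel_pow E (walk_p \<mu>) n x y > 0" if "x \<in> E" "y \<in> E" for x y
      using assms(3) that unfolding irreducible_on_def walk_law
      by (simp add: emeasure_killed_at[OF walk_p_substochastic])
  qed (use assms in \<open>auto simp: add.commute\<close>)

  \<comment> \<open>Translation of the definitions into kernel powers\<close>
  have green: "green (walk_law \<mu> E) x y = (\<Sum>n. pow n x y)" if "x \<in> E" "y \<in> E" for x y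
    unfolding walk_law using that by (rule green_killed[OF substochastic])
  have life: "expected_lifetime (walk_law \<mu> E) x = (\<Sum>n. mass n x)" if "x \<in> E" for x
    unfolding walk_law using that by (rule expected_lifetime_killed[OF substochastic])
  have surv: "survival (walk_law \<mu> E) x n = mass n x" if "x \<in> E" for x n
    unfolding walk_law using that by (rule survival_killed[OF substochastic])
  \<comment> \<open>Exchanging the sums over time and position expands the Green function, and
    \<open>\<mu>(y - z - x)\<close> is the step from \<open>x + z\<close> to
    \<open>y\<close>.\<close>
  have ladder_p: "ladder_p \<mu> E = ladder_kernel"
  proof (intro ext)
    fix x y
    show "ladder_p \<mu> E x y = ladder_kernel x y"
    proof (cases "y \<in> E - (+) x ` E")
      case True
      have "ladder_p \<mu> E x y = (\<integral>\<^sup>+z. (\<Sum>n. pow n 0 z) * walk_p \<mu> (x + z) y \<partial>count_space E)"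
        unfolding ladder_p_def ladder_a_def if_P[OF True]
        by (intro nn_integral_cong) (simp add: green zero_mem walk_p_def diff_diff_eq add.commute)
      also have "\<dots> = (\<Sum>n. \<integral>\<^sup>+z. pow n 0 z * walk_p \<mu> (x + z) y \<partial>count_space E)"
        by (simp add: nn_integral_suminf[symmetric])
      finally show ?thesis
        using True unfolding ladder_kernel_def exit_kernel_def by simp
    next
      case False
      show ?thesis
        unfolding ladder_p_def ladder_a_def ladder_kernel_def exit_kernel_def if_not_P[OF False] by simp
    qed
  qed
  have ladder_law: "ladder_law \<mu> E = (\<lambda>x. chain_law (cemetery_kernel E ladder_kernel) (Some x))"
    by (rule ext) (simp add: ladder_law_def ladder_p)
  have sub: "(\<integral>\<^sup>+y. ladder_kernel x y \<partial>count_space E) \<le> 1" for x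
    using ladder_p_substochastic[of E \<mu> x] by (simp add: ladder_p)
  have ladder_V: "ladder_V \<mu> E (Some x) = V x" if "x \<in> E" for x
    using that unfolding ladder_V_def ladder_law
    by (simp add: expected_lifetime_killed[OF sub] suminf_ladder_mass)

  \<comment> \<open>The four assertions\<close>
  have transient: "transient_on E (ladder_law \<mu> E)"
    unfolding ladder_law using sub
    by (rule transient_on_killed) (use suminf_ladder_mass V_finite in auto)
  have additive: "ladder_V \<mu> E (Some (x + u)) =
      ladder_V \<mu> E (Some x) +
      (\<integral>\<^sup>+\<omega>\<in>{\<omega>. exit_time E u \<omega> < lifetime \<omega>}.
         ladder_V \<mu> E (\<omega> (the_enat (exit_time E u \<omega>))) \<partial>walk_law \<mu> E (x + u))"
    if "x \<in> E" "u \<in> E" for x u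
  proof -
    have "(\<integral>\<^sup>+w. (\<Sum>n. exit_kernel n x u w) * ladder_V \<mu> E (Some w) \<partial>count_space E) =
        (\<integral>\<^sup>+w. (\<Sum>n. exit_kernel n x u w) * V w \<partial>count_space E)"
      by (intro nn_integral_cong) (simp add: ladder_V)
    then show ?thesis
      using V_add[OF that] nn_integral_at_exit[OF that, of "ladder_V \<mu> E"] that add_mem
      unfolding walk_law exit_time_def by (simp add: ladder_V add.commute[of x u])
  qed
  have harmonic: "harmonic_on \<mu> E (\<lambda>x. ladder_V \<mu> E (Some x))"
    and ratio: "x \<in> E \<Longrightarrow> (\<lambda>n. survival (walk_law \<mu> E) x n / survival (walk_law \<mu> E) 0 n)
                  \<longlonglongrightarrow> ladder_V \<mu> E (Some x)"
    if "\<forall>x\<in>E. expected_lifetime (walk_law \<mu> E) x = \<infinity>" for x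
  proof -
    have inf: "(\<Sum>n. mass n 0) = \<infinity>"
      using that zero_mem by (simp add: life)
    have "(\<integral>\<^sup>+y. walk_p \<mu> x y * ladder_V \<mu> E (Some y) \<partial>count_space E) = V x" if "x \<in> E" for x
      unfolding V_harmonic[OF inf that, symmetric] by (intro nn_integral_cong) (simp add: ladder_V)
    then show "harmonic_on \<mu> E (\<lambda>x. ladder_V \<mu> E (Some x))"
      using V_finite zero_mem unfolding harmonic_on_def
      by (auto simp: ladder_V intro!: bexI[of _ 0])
    show "(\<lambda>n. survival (walk_law \<mu> E) x n / survival (walk_law \<mu> E) 0 n) \<longlonglongrightarrow> ladder_V \<mu> E (Some x)"
      if "x \<in> E"
      using mass_ratio_tendsto_V[OF inf that] that zero_mem by (simp add: surv ladder_V)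
  qed
  have potential: "potential_on \<mu> E (\<lambda>x. ladder_V \<mu> E (Some x))"
    and quotient: "x \<in> E \<Longrightarrow> ladder_V \<mu> E (Some x) =
        expected_lifetime (walk_law \<mu> E) x / expected_lifetime (walk_law \<mu> E) 0"
    if fin: "\<forall>x\<in>E. expected_lifetime (walk_law \<mu> E) x < \<infinity>" for x
  proof -
    let ?A = "\<Sum>n. mass n 0"
    \<comment> \<open>The term \<open>mass 0 0 = 1\<close> keeps the denominator away from
      zero.\<close>
    have "mass 0 0 \<le> ?A"
      using sum_le_suminf[of "\<lambda>n. mass n 0" "{0}"] by simp
    then have A: "?A \<noteq> 0" "?A \<noteq> top"
      using fin life[OF zero_mem] zero_mem by auto
    have V: "V x = (\<Sum>n. mass n x) / ?A" if "x \<in> E" for x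
      using A by (simp add: suminf_mass[OF that] ennreal_mult_divide_eq)
    then show "x \<in> E \<Longrightarrow> ladder_V \<mu> E (Some x) =
        expected_lifetime (walk_law \<mu> E) x / expected_lifetime (walk_law \<mu> E) 0"
      by (simp add: ladder_V life zero_mem)
    \<comment> \<open>The Green function summed over \<open>y\<close> is the expected lifetime from
      \<open>x\<close>, so the constant charge \<open>1 / ?A\<close> represents \<open>V\<close> as
      a potential.\<close>
    have "V x = (\<integral>\<^sup>+y. green (walk_law \<mu> E) x y * (1 / ?A) \<partial>count_space E)" if "x \<in> E" for x
    proof -
      have "V x = (\<integral>\<^sup>+y. (\<Sum>n. pow n x y) * (1 / ?A) \<partial>count_space E)"
        unfolding V[OF that] suminf_kernel_mass by (simp add: nn_integral_divide ennreal_times_divide)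
      also have "\<dots> = (\<integral>\<^sup>+y. green (walk_law \<mu> E) x y * (1 / ?A) \<partial>count_space E)"
        using that by (intro nn_integral_cong) (simp add: green)
      finally show ?thesis .
    qed
    moreover have "1 / ?A < \<infinity>"
      using A by (simp add: less_top[symmetric] ennreal_divide_eq_top_iff)
    ultimately show "potential_on \<mu> E (\<lambda>x. ladder_V \<mu> E (Some x))"
      using V_finite unfolding potential_on_def by (auto simp: ladder_V intro!: exI[of _ "\<lambda>_. 1 / ?A"])
  qed
  have liminf: "ladder_V \<mu> E (Some x) \<le>
      liminf (\<lambda>n. survival (walk_law \<mu> E) x n / survival (walk_law \<mu> E) 0 n)" if "x \<in> E" for x
    using V_le_liminf[OF that] that zero_mem by (simp add: surv ladder_V)
  have finite: "ladder_V \<mu> E (Some x) < \<infinity>" if "x \<in> E" for x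
    using V_finite[OF that] that by (simp add: ladder_V)
  have at_0: "ladder_V \<mu> E (Some 0) = 1"
    by (simp add: ladder_V zero_mem)
  show ?thesis
    by (intro conjI impI ballI;
      (rule transient finite at_0 additive harmonic ratio potential quotient liminf; assumption))
qed

end
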